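(* Let $T$ be a trivalent leafless tree, let $P$ be the set of bi-infinite paths (bips) on $T$ constructed as described in the context, and let $A\in\{\mathbb{Z},\mathbb{Z}_2\}$. Then the map \[ \ell^\infty(P)\to H^{\mathrm{suf}}_1(T,A)\cong H^{\mathrm{uf}}_1(T,A),\qquad f\mapsto c_f:=\Big[e\mapsto \sum_{p\in P,\ e\in p} f(p)\Big] \] is an isomorphism (continuous when $A=\mathbb{Z}$ and $H^{\mathrm{suf}}_1(T,A)$ carries the $\ell^\infty$ norm).
   Context: $H^{\mathrm{suf}}_1(T,A)$ is the first simplicial uniformly finite homology of $T$ (homology of the complex of uniformly bounded $A$-valued simplicial chains), and $H^{\mathrm{uf}}_1(T,A)$ is the first uniformly finite homology of Block–Weinberger (direct limit over Rips complexes); since $T$ is a tree, $H^{\mathrm{suf}}_1(T,A)$ is just the space of uniformly bounded $A$-valued flows on $T$ satisfying in-flow $=$ out-flow at every vertex. A trivalent tree is a tree all of whose vertices have degree $2$ or $3$. A bip is a bi-infinite path, i.e. a graph morphism $\mathbb{Z}\to T$ injective on edges, viewed as an oriented $1$-cycle. Construction of $T$: start with $T_0=\{v_0\}$; $T_1$ is a copy of $\mathbb{Z}$ with $v_0=0$ (i.e. two rays issuing from $v_0$). Inductively, choose a set $B_n$ of vertices of $T_n$ not in $T_{n-1}$ (branching points of depth $n$), and at each $v\in B_n$ glue a new ray $R_v\cong\mathbb{N}$ at its origin $0_v=v$; write $\infty_v$ for its end. $T_{n+1}$ is the result and $T=\bigcup_n T_n$ (every trivalent leafless tree arises this way up to one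 edge). Every new branching point lies on a ray created at the previous step; for such a ray $R_u$, order the branching points lying on it (other than $u$) by their position along $R_u$ as $v_{u,0},v_{u,1},\dots$. Construction of $P$: $P_0=\emptyset$, $P_1=\{T_1\}$ (the unique bip of $T_1$). Then $P_{n+1}=P_n\sqcup P'_{n+1}$ where, for each ray $R_u$ created at the previous stage, the new bips along $R_u$ are: for each consecutive pair, the path $R_{v_{u,i}}^{-1}+[v_{u,i},v_{u,i+1}]+R_{v_{u,i+1}}$ (come in along the ray at $v_{u,i}$, follow $R_u$ to $v_{u,i+1}$, go out along the ray at $v_{u,i+1}$); and if there are only finitely many branching points $v_{u,0},\dots,v_{u,k}$ on $R_u$, additionally the bip $R_{v_{u,k}}^{-1}+[v_{u,k},\infty_u]$ (come in along the ray at $v_{u,k}$ and follow $R_u$ out to its end). $P=\bigcup_n P_n$. Partially order $P$ by declaring $p\le q$ whenever $p\in P_n$, $q\in P_{n+1}$ share an edge, and taking the transitive closure; this can be refined to a well-order with finite initial segments. The resulting $P$ is "tame": each edge is covered by at most three bips, $P_n$ covers $T_n$, each $p$ has finitely many predecessors and is the last bip over a nonempty connected set of edges $M_p$, and for every edge $e$ on which $p$ is last there is an edge $e'$ on which exactly the predecessors of $p$ through $e$ run. *)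

theory Defs
  imports Complex_Main "HOL-Algebra.Coset" "HOL-Library.Z2"
begin

section \<open>Coefficients and bounded functions\<close>

class coeff_ring = comm_ring_1 +
  fixes cnorm :: "'a \<Rightarrow> real"

instantiation int :: coeff_ring
begin
definition cnorm_int :: "int \<Rightarrow> real" where "cnorm_int a = \<bar>real_of_int a\<bar>"
instance ..
end

instantiation bit :: coeff_ring
begin
definition cnorm_bit :: "bit \<Rightarrow> real" where "cnorm_bit a = of_bool (a \<noteq> 0)"
instance ..
end

definition bounded_fun :: "('x \<Rightarrow> 'a::coeff_ring) \<Rightarrow> bool" where
  "bounded_fun f \<longleftrightarrow> (\<exists>K. \<forall>x. cnorm (f x) \<le> K)"

definition sup_norm :: "('x \<Rightarrow> 'a::coeff_ring) \<Rightarrow> real" where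
  "sup_norm f = (SUP x. cnorm (f x))"

definition fun_group :: "('x \<Rightarrow> 'a::ab_group_add) set \<Rightarrow> ('x \<Rightarrow> 'a) monoid" where
  "fun_group S = \<lparr>carrier = S, mult = (\<lambda>f g x. f x + g x), one = (\<lambda>x. 0)\<rparr>"

text \<open>Functions on \<open>P\<close> are represented by their extension by \<open>0\<close>.\<close>

definition linf :: "'x set \<Rightarrow> ('x \<Rightarrow> 'a::coeff_ring) monoid" where
  "linf P = fun_group {f. (\<forall>x. x \<notin> P \<longrightarrow> f x = 0) \<and> bounded_fun f}"


section \<open>Simplicial uniformly finite homology\<close>

text \<open>
  A simplicial complex is given by its set \<open>K\<close> of simplices, each a finite nonempty set of
  vertices. An \<open>n\<close>-chain is a bounded alternating function on the ordered \<open>n\<close>-simplices: the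
  value at \<open>[x\<^sub>0, \<dots>, x\<^sub>n]\<close> is the coefficient of that oriented simplex. The sum in
  \<open>bdry\<close> is finite if \<open>K\<close> is locally finite.
\<close>

definition chains :: "'v set set \<Rightarrow> nat \<Rightarrow> ('v list \<Rightarrow> 'a::coeff_ring) set" where
  "chains K n = {c. bounded_fun c \<and>
     (\<forall>xs. c xs \<noteq> 0 \<longrightarrow> length xs = Suc n \<and> distinct xs \<and> set xs \<in> K) \<and>
     (\<forall>xs i j. i < j \<and> j < length xs \<longrightarrow> c (xs[i := xs ! j, j := xs ! i]) = - c xs)}"

definition bdry :: "('v list \<Rightarrow> 'a::coeff_ring) \<Rightarrow> 'v list \<Rightarrow> 'a" where
  "bdry c ys = (if ys = [] then 0 else \<Sum>x | c (x # ys) \<noteq> 0. c (x # ys))"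

definition cycles :: "'v set set \<Rightarrow> nat \<Rightarrow> ('v list \<Rightarrow> 'a::coeff_ring) set" where
  "cycles K n = {c \<in> chains K n. bdry c = (\<lambda>ys. 0)}"

definition boundaries :: "'v set set \<Rightarrow> nat \<Rightarrow> ('v list \<Rightarrow> 'a::coeff_ring) set" where
  "boundaries K n = bdry ` chains K (Suc n)"

definition H_suf :: "'v set set \<Rightarrow> nat \<Rightarrow> ('v list \<Rightarrow> 'a::coeff_ring) set monoid" where
  "H_suf K n = fun_group (cycles K n) Mod boundaries K n"

definition hclass :: "'v set set \<Rightarrow> nat \<Rightarrow> ('v list \<Rightarrow> 'a::coeff_ring) \<Rightarrow> ('v list \<Rightarrow> 'a) set" where
  "hclass K n z = boundaries K n #>\<^bsub>fun_group (cycles K n)\<^esub> z"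

text \<open>The map \<open>H_suf K n \<rightarrow> H_suf K' n\<close> induced by an inclusion \<open>K \<subseteq> K'\<close>.\<close>

definition incl_map ::
  "'v set set \<Rightarrow> nat \<Rightarrow> ('v list \<Rightarrow> 'a::coeff_ring) set \<Rightarrow> ('v list \<Rightarrow> 'a) set" where
  "incl_map K' n X = (\<Union>z\<in>X. hclass K' n z)"

text \<open>The quotient (semi)norm of the sup norm, and the distance it induces.\<close>

definition class_norm :: "('x \<Rightarrow> 'a::coeff_ring) set \<Rightarrow> real" where
  "class_norm X = (INF z\<in>X. sup_norm z)"

definition class_dist :: "('x \<Rightarrow> 'a::coeff_ring) set \<Rightarrow> ('x \<Rightarrow> 'a) set \<Rightarrow> real" where
  "class_dist X Y = class_norm {(\<lambda>x. y x - z x) |y z. y \<in> X \<and> z \<in> Y}"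


section \<open>Graphs and trees\<close>

definition simple_graph :: "'v set \<Rightarrow> 'v set set \<Rightarrow> bool" where
  "simple_graph V E \<longleftrightarrow> (\<forall>e\<in>E. \<exists>x\<in>V. \<exists>y\<in>V. x \<noteq> y \<and> e = {x, y})"

definition walk :: "'v set \<Rightarrow> 'v set set \<Rightarrow> 'v list \<Rightarrow> bool" where
  "walk V E xs \<longleftrightarrow> xs \<noteq> [] \<and> set xs \<subseteq> V \<and> successively (\<lambda>x y. {x, y} \<in> E) xs"

definition tree :: "'v set \<Rightarrow> 'v set set \<Rightarrow> bool" where
  "tree V E \<longleftrightarrow> simple_graph V E \<and> V \<noteq> {} \<and>
     (\<forall>x\<in>V. \<forall>y\<in>V. \<exists>xs. walk V E xs \<and> hd xs = x \<and> last xs = y) \<and>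
     \<not> (\<exists>xs. walk V E xs \<and> distinct xs \<and> length xs \<ge> 3 \<and> {last xs, hd xs} \<in> E)"

definition vdegree :: "'v set set \<Rightarrow> 'v \<Rightarrow> nat" where
  "vdegree E v = card {e \<in> E. v \<in> e}"

definition trivalent_tree :: "'v set \<Rightarrow> 'v set set \<Rightarrow> bool" where
  "trivalent_tree V E \<longleftrightarrow> tree V E \<and> (\<forall>v\<in>V. vdegree E v \<in> {2, 3})"

definition leafless :: "'v set \<Rightarrow> 'v set set \<Rightarrow> bool" where
  "leafless V E \<longleftrightarrow> (\<forall>v\<in>V. vdegree E v \<noteq> 1)"

definition gdist :: "'v set \<Rightarrow> 'v set set \<Rightarrow> 'v \<Rightarrow> 'v \<Rightarrow> nat" where
  "gdist V E x y = (LEAST n. \<exists>xs. walk V E xs \<and> hd xs = x \<and> last xs = y \<and> length xs = Suc n)"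

definition graph_complex :: "'v set \<Rightarrow> 'v set set \<Rightarrow> 'v set set" where
  "graph_complex V E = (\<lambda>v. {v}) ` V \<union> E"


section \<open>Uniformly finite homology\<close>

definition rips :: "'v set \<Rightarrow> 'v set set \<Rightarrow> nat \<Rightarrow> 'v set set" where
  "rips V E r = {s. s \<noteq> {} \<and> finite s \<and> s \<subseteq> V \<and> (\<forall>x\<in>s. \<forall>y\<in>s. gdist V E x y \<le> r)}"

definition dirlim_rel ::
  "(nat \<Rightarrow> 'g monoid) \<Rightarrow> (nat \<Rightarrow> nat \<Rightarrow> 'g \<Rightarrow> 'g) \<Rightarrow> ((nat \<times> 'g) \<times> (nat \<times> 'g)) set" where
  "dirlim_rel G \<phi> = {((m, a), (n, b)). a \<in> carrier (G m) \<and> b \<in> carrier (G n) \<and>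
     (\<exists>k. m \<le> k \<and> n \<le> k \<and> \<phi> m k a = \<phi> n k b)}"

definition dirlim ::
  "(nat \<Rightarrow> 'g monoid) \<Rightarrow> (nat \<Rightarrow> nat \<Rightarrow> 'g \<Rightarrow> 'g) \<Rightarrow> (nat \<times> 'g) set monoid" where
  "dirlim G \<phi> =
     \<lparr>carrier = (SIGMA m:UNIV. carrier (G m)) // dirlim_rel G \<phi>,
      mult = (\<lambda>X Y. \<Union>(m, a)\<in>X. \<Union>(n, b)\<in>Y. let k = max m n in
                dirlim_rel G \<phi> `` {(k, \<phi> m k a \<otimes>\<^bsub>G k\<^esub> \<phi> n k b)}),
      one = dirlim_rel G \<phi> `` {(0, \<one>\<^bsub>G 0\<^esub>)}\<rparr>"

text \<open>
  The vertex set carries the path metric, which is integer valued, so that integer scales of the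
  Rips complex suffice.
\<close>

definition H_uf ::
  "'v set \<Rightarrow> 'v set set \<Rightarrow> nat \<Rightarrow> (nat \<times> ('v list \<Rightarrow> 'a::coeff_ring) set) set monoid" where
  "H_uf V E n = dirlim (\<lambda>r. H_suf (rips V E r) n) (\<lambda>r s. incl_map (rips V E s) n)"

text \<open>
  The canonical map from \<open>H_suf\<close> of a graph to \<open>H_uf\<close>, induced by the inclusion of the graph in
  its Rips complex at scale \<open>1\<close>.
\<close>

definition suf_to_uf ::
  "'v set \<Rightarrow> 'v set set \<Rightarrow> nat \<Rightarrow> ('v list \<Rightarrow> 'a::coeff_ring) set \<Rightarrow>
     (nat \<times> ('v list \<Rightarrow> 'a) set) set" where
  "suf_to_uf V E n X =
     dirlim_rel (\<lambda>r. H_suf (rips V E r) n) (\<lambda>r s. incl_map (rips V E s) n)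
       `` {(1, incl_map (rips V E 1) n X)}"


section \<open>Building the tree from rays\<close>

text \<open>
  \<open>L\<close> parametrises the line \<open>T\<^sub>1\<close>, \<open>B n\<close> is the set of branching points of depth \<open>n \<ge> 1\<close>, and
  \<open>R v\<close> is the ray glued at the branching point \<open>v\<close>.

  The flag \<open>mid\<close> tells where the root \<open>v\<^sub>0\<close> is. If it is false, then \<open>v\<^sub>0 = L 0\<close>; this vertex
  never branches, so it has degree \<open>2\<close> in the final tree. A tree all of whose vertices have
  degree \<open>3\<close> is only obtained up to suppressing this degree \<open>2\<close> vertex, i.e. merging the two edges
  at \<open>v\<^sub>0\<close> into one. This is the case where \<open>mid\<close> is true: \<open>v\<^sub>0\<close> is the midpoint of the edge
  \<open>{L 0, L 1}\<close> and not a vertex. In both cases the vertices other than \<open>v\<^sub>0\<close> on the two rays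
  issuing from \<open>v\<^sub>0\<close> are the values of the two functions in \<open>rays \<dots> (Suc 0)\<close> at positions
  \<open>i \<ge> 1\<close>; if \<open>mid\<close> is true, each of the two functions starts by crossing the whole edge
  \<open>{L 0, L 1}\<close>.
\<close>

fun stage_verts ::
  "bool \<Rightarrow> (int \<Rightarrow> 'v) \<Rightarrow> (nat \<Rightarrow> 'v set) \<Rightarrow> ('v \<Rightarrow> nat \<Rightarrow> 'v) \<Rightarrow> nat \<Rightarrow> 'v set" where
  "stage_verts mid L B R 0 = (if mid then {} else {L 0})"
| "stage_verts mid L B R (Suc 0) = range L"
| "stage_verts mid L B R (Suc (Suc n)) =
     stage_verts mid L B R (Suc n) \<union> (\<Union>v\<in>B (Suc n). range (R v))"

fun stage_edges ::
  "(int \<Rightarrow> 'v) \<Rightarrow> (nat \<Rightarrow> 'v set) \<Rightarrow> ('v \<Rightarrow> nat \<Rightarrow> 'v) \<Rightarrow> nat \<Rightarrow> 'v set set" where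
  "stage_edges L B R 0 = {}"
| "stage_edges L B R (Suc 0) = range (\<lambda>k. {L k, L (k + 1)})"
| "stage_edges L B R (Suc (Suc n)) =
     stage_edges L B R (Suc n) \<union> (\<Union>v\<in>B (Suc n). range (\<lambda>i. {R v i, R v (Suc i)}))"

definition ray_construction ::
  "'v set \<Rightarrow> 'v set set \<Rightarrow> bool \<Rightarrow> (int \<Rightarrow> 'v) \<Rightarrow> (nat \<Rightarrow> 'v set) \<Rightarrow> ('v \<Rightarrow> nat \<Rightarrow> 'v) \<Rightarrow> bool" where
  "ray_construction V E mid L B R \<longleftrightarrow>
     inj L \<and>
     (\<forall>n\<ge>1. B n \<subseteq> stage_verts mid L B R n - stage_verts mid L B R (n - 1)) \<and>
     (\<forall>n\<ge>1. \<forall>v\<in>B n. R v 0 = v \<and> inj (R v) \<and> (\<forall>i. R v (Suc i) \<notin> stage_verts mid L B R n)) \<and>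
     (\<forall>n\<ge>1. \<forall>v\<in>B n. \<forall>w\<in>B n. v \<noteq> w \<longrightarrow> range (R v) \<inter> range (R w) = {}) \<and>
     V = (\<Union>n. stage_verts mid L B R n) \<and>
     E = (\<Union>n. stage_edges L B R n)"

fun rays ::
  "bool \<Rightarrow> (int \<Rightarrow> 'v) \<Rightarrow> (nat \<Rightarrow> 'v set) \<Rightarrow> ('v \<Rightarrow> nat \<Rightarrow> 'v) \<Rightarrow> nat \<Rightarrow> (nat \<Rightarrow> 'v) set" where
  "rays mid L B R 0 = {}"
| "rays mid L B R (Suc 0) = {\<lambda>i. L (int i), \<lambda>i. L (of_bool mid - int i)}"
| "rays mid L B R (Suc (Suc n)) = R ` B (Suc n)"


section \<open>The bi-infinite paths\<close>

text \<open>For a ray \<open>r\<close> with branching points \<open>v = r i\<close> and \<open>w = r j\<close>, \<open>i < j\<close>: the path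
  \<open>R\<^sub>v\<^sup>-\<^sup>1 + [v, w] + R\<^sub>w\<close>, and the path \<open>R\<^sub>v\<^sup>-\<^sup>1 + [v, \<infinity>]\<close>, both passing through \<open>v\<close> at time \<open>0\<close>.\<close>

definition join_bip :: "('v \<Rightarrow> nat \<Rightarrow> 'v) \<Rightarrow> (nat \<Rightarrow> 'v) \<Rightarrow> nat \<Rightarrow> nat \<Rightarrow> int \<Rightarrow> 'v" where
  "join_bip R r i j k =
     (if k \<le> 0 then R (r i) (nat (- k))
      else if k \<le> int (j - i) then r (i + nat k)
      else R (r j) (nat (k - int (j - i))))"

definition end_bip :: "('v \<Rightarrow> nat \<Rightarrow> 'v) \<Rightarrow> (nat \<Rightarrow> 'v) \<Rightarrow> nat \<Rightarrow> int \<Rightarrow> 'v" where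
  "end_bip R r i k = (if k \<le> 0 then R (r i) (nat (- k)) else r (i + nat k))"

definition branch_pos :: "'v set \<Rightarrow> (nat \<Rightarrow> 'v) \<Rightarrow> nat set" where
  "branch_pos S r = {i. 1 \<le> i \<and> r i \<in> S}"

definition ray_bips :: "('v \<Rightarrow> nat \<Rightarrow> 'v) \<Rightarrow> 'v set \<Rightarrow> (nat \<Rightarrow> 'v) \<Rightarrow> (int \<Rightarrow> 'v) set" where
  "ray_bips R S r =
     {join_bip R r i j |i j. i \<in> branch_pos S r \<and> j \<in> branch_pos S r \<and> i < j \<and>
        (\<forall>k\<in>branch_pos S r. \<not> (i < k \<and> k < j))} \<union>
     {end_bip R r i |i. i \<in> branch_pos S r \<and> (\<forall>k\<in>branch_pos S r. k \<le> i)}"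

fun bips_upto ::
  "bool \<Rightarrow> (int \<Rightarrow> 'v) \<Rightarrow> (nat \<Rightarrow> 'v set) \<Rightarrow> ('v \<Rightarrow> nat \<Rightarrow> 'v) \<Rightarrow> nat \<Rightarrow> (int \<Rightarrow> 'v) set" where
  "bips_upto mid L B R 0 = {}"
| "bips_upto mid L B R (Suc 0) = {L}"
| "bips_upto mid L B R (Suc (Suc n)) =
     bips_upto mid L B R (Suc n) \<union> (\<Union>r\<in>rays mid L B R (Suc n). ray_bips R (B (Suc n)) r)"

definition bips ::
  "bool \<Rightarrow> (int \<Rightarrow> 'v) \<Rightarrow> (nat \<Rightarrow> 'v set) \<Rightarrow> ('v \<Rightarrow> nat \<Rightarrow> 'v) \<Rightarrow> (int \<Rightarrow> 'v) set" where
  "bips mid L B R = (\<Union>n. bips_upto mid L B R n)"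

text \<open>The oriented \<open>1\<close>-cycle of a path that crosses every edge at most once.\<close>

definition bip_chain :: "(int \<Rightarrow> 'v) \<Rightarrow> 'v list \<Rightarrow> 'a::coeff_ring" where
  "bip_chain p xs =
     (if \<exists>k. xs = [p k, p (k + 1)] then 1
      else if \<exists>k. xs = [p (k + 1), p k] then - 1
      else 0)"

definition bip_edges :: "(int \<Rightarrow> 'v) \<Rightarrow> 'v set set" where
  "bip_edges p = range (\<lambda>k. {p k, p (k + 1)})"

definition bip_sum :: "(int \<Rightarrow> 'v) set \<Rightarrow> ((int \<Rightarrow> 'v) \<Rightarrow> 'a::coeff_ring) \<Rightarrow> 'v list \<Rightarrow> 'a" where
  "bip_sum P f xs = (\<Sum>p | p \<in> P \<and> set xs \<in> bip_edges p. f p * bip_chain p xs)"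

definition bip_map ::
  "'v set \<Rightarrow> 'v set set \<Rightarrow> (int \<Rightarrow> 'v) set \<Rightarrow> ((int \<Rightarrow> 'v) \<Rightarrow> 'a::coeff_ring) \<Rightarrow>
     ('v list \<Rightarrow> 'a) set" where
  "bip_map V E P f = hclass (graph_complex V E) 1 (bip_sum P f)"

end

theory Submission
  imports Defs
begin

text \<open>
  A tree carries no \<open>2\<close>-simplices, so \<open>H_suf\<close> in degree \<open>1\<close> is the group of bounded flows.

  Every ray \<open>r\<close> of the construction is crossed with constant multiplicity by the bips that use
  \<open>r\<close> as an end, and besides these each of its edges lies on at most one bip, namely the one
  issuing from the last branching point before that edge. Hence the flow \<open>c\<close> of \<open>f\<close> satisfies
  \<open>f(p) = c[r i, r (i+1)] - c[r 0, r 1]\<close> for the bip \<open>p\<close> that starts at the branching point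
  \<open>r i\<close>, and \<open>f(L) = c[L 0, L 1]\<close>. For an arbitrary flow \<open>c\<close> these formulas define a bounded
  preimage: by the conservation law both flows agree along each ray once they agree on its first
  edge, and on the first edge of the ray at \<open>v\<close> both are the defect at \<open>v\<close> of the ray through \<open>v\<close>.

  For uniformly finite homology, a \<open>1\<close>-cycle at scale \<open>r + 1\<close> is pushed to scale \<open>r\<close> by
  replacing each longest edge by the two other sides of a triangle through an intermediate vertex,
  which gives surjectivity. Conversely, removing an edge splits the tree in two, and the total
  amount a boundary carries from one part to the other vanishes by antisymmetry, while a flow
  carries its value on that edge; so a flow that bounds at some scale is zero.
\<close>

text \<open>Everything is computed in ray coordinates. A vertex has exactly one pair
  \<open>(r, k)\<close> with \<open>k \<ge> 1\<close>, except an unsuppressed root, which has none;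
  position 0 is excluded because a glued ray shares it with the ray that carries it. Every edge is a
  step from \<open>r k\<close> to \<open>r (Suc k)\<close>, and a bip other than \<open>L\<close> is
  named by the branching point where it comes in, so that the overlapping paths become a family
  indexed by vertices. The obstacle is a suppressed root: \<open>{L 0, L 1}\<close> is then the
  first step of both line rays, in opposite directions, and every argument on the uniqueness of
  edges has to allow for it. The values of the preimage are differences of two values of the flow,
  so no errors accumulate along a ray or from stage to stage, and boundedness is immediate. Both
  coefficient groups are treated at once by a class with a subadditive norm. It includes
  characteristic 2, where \<open>x = - x\<close> does not give \<open>x = 0\<close>; antisymmetric
  sums are therefore cancelled in pairs.\<close>

section \<open>Bounded chains\<close>

text \<open>\<open>coeff_ring\<close> only names a norm. These laws hold for the absolute value on
  the integers and for the discrete norm on the two-element field, and they give boundedness of sums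
  and of boundaries.\<close>

class normed_coeff_ring = coeff_ring +
  assumes cnorm_zero [simp]: "cnorm 0 = 0"
    and cnorm_minus [simp]: "cnorm (- a) = cnorm a"
    and cnorm_add: "cnorm (a + b) \<le> cnorm a + cnorm b"
begin

lemma cnorm_nonneg: "0 \<le> cnorm a"
  using cnorm_add[of a "- a"] by simp

lemma cnorm_diff: "cnorm (a - b) \<le> cnorm a + cnorm b"
  using cnorm_add[of a "- b"] by simp

lemma cnorm_sum: "cnorm (\<Sum>x\<in>A. f x) \<le> (\<Sum>x\<in>A. cnorm (f x))"
  by (induction A rule: infinite_finite_induct) (auto intro: order_trans[OF cnorm_add])

end

instance int :: normed_coeff_ring
  by standard (auto simp: cnorm_int_def)

instance bit :: normed_coeff_ring
proof
  fix a b :: bit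
  show "cnorm (a + b) \<le> cnorm a + cnorm b" by (cases a; cases b) (auto simp: cnorm_bit_def)
qed (auto simp: cnorm_bit_def)

lemma bounded_fun_pos:
  assumes "bounded_fun f"
  obtains M where "M \<ge> 0" "\<And>x. cnorm (f x) \<le> M"
proof -
  obtain M where "\<forall>x. cnorm (f x) \<le> M" using assms unfolding bounded_fun_def by blast
  then show ?thesis using that[of "max M 0"] by (meson max.cobounded1 max.cobounded2 order_trans)
qed

lemma bounded_fun_zero: "bounded_fun (\<lambda>x. 0 :: 'a::normed_coeff_ring)"
  unfolding bounded_fun_def by auto

lemma bounded_fun_minus: "bounded_fun f \<Longrightarrow> bounded_fun (\<lambda>x. - f x :: 'a::normed_coeff_ring)"
  unfolding bounded_fun_def by auto

lemma bounded_fun_add: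
  fixes f g :: "'x \<Rightarrow> 'a::normed_coeff_ring"
  assumes "bounded_fun f" "bounded_fun g"
  shows "bounded_fun (\<lambda>x. f x + g x)"
proof -
  obtain M N where "\<And>x. cnorm (f x) \<le> M" "\<And>x. cnorm (g x) \<le> N"
    using assms unfolding bounded_fun_def by blast
  then have "cnorm (f x + g x) \<le> M + N" for x
    using cnorm_add[of "f x" "g x"] by (meson add_mono order_trans)
  then show ?thesis unfolding bounded_fun_def by blast
qed

lemma sup_norm_upper: "bounded_fun f \<Longrightarrow> cnorm (f x) \<le> sup_norm f"
  unfolding sup_norm_def bounded_fun_def by (intro cSUP_upper) (auto simp: bdd_above_def)

text \<open>In characteristic 2 a sum equal to its own negative need not vanish, and antisymmetry
  says nothing about the diagonal. Hence \<open>g x y\<close> is cancelled against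
  \<open>g y x\<close> pair by pair, with the diagonal assumed to be zero.\<close>

lemma sum_antisymmetric_eq_0:
  fixes g :: "'x \<Rightarrow> 'x \<Rightarrow> 'a::ab_group_add"
  assumes "finite A" "\<And>x y. g x y = - g y x" "\<And>x. g x x = 0"
  shows "(\<Sum>x\<in>A. \<Sum>y\<in>A. g x y) = 0"
  using assms(1)
proof (induction A rule: finite_induct)
  case (insert a A)
  have "(\<Sum>x\<in>insert a A. \<Sum>y\<in>insert a A. g x y) = (\<Sum>y\<in>A. g a y) + (\<Sum>x\<in>A. g x a)"
    using insert assms(3) by (simp add: sum.distrib)
  also have "(\<Sum>x\<in>A. g x a) = - (\<Sum>y\<in>A. g a y)"
    using assms(2)[of _ a] by (simp add: sum_negf)
  finally show ?case by simp
qed simp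

lemma comm_group_fun_group:
  fixes S :: "('x \<Rightarrow> 'a::ab_group_add) set"
  assumes "(\<lambda>x. 0) \<in> S" "\<And>f g. f \<in> S \<Longrightarrow> g \<in> S \<Longrightarrow> (\<lambda>x. f x + g x) \<in> S"
    and "\<And>f. f \<in> S \<Longrightarrow> (\<lambda>x. - f x) \<in> S"
  shows "comm_group (fun_group S)"
proof (rule comm_groupI)
  show "\<exists>y\<in>carrier (fun_group S). y \<otimes>\<^bsub>fun_group S\<^esub> f = \<one>\<^bsub>fun_group S\<^esub>"
    if "f \<in> carrier (fun_group S)" for f
    using that assms(3)[of f] by (auto simp: fun_group_def intro!: bexI[of _ "\<lambda>x. - f x"])
qed (use assms in \<open>auto simp: fun_group_def add_ac\<close>)

section \<open>Bounded alternating chains\<close>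

lemma chains_zero: "(\<lambda>xs. 0 :: 'a::normed_coeff_ring) \<in> chains K n"
  unfolding chains_def by (auto simp: bounded_fun_zero)

lemma chains_minus: "c \<in> chains K n \<Longrightarrow> (\<lambda>xs. - c xs :: 'a::normed_coeff_ring) \<in> chains K n"
  unfolding chains_def by (auto simp: bounded_fun_minus)

lemma chains_add:
  fixes c d :: "'v list \<Rightarrow> 'a::normed_coeff_ring"
  assumes "c \<in> chains K n" "d \<in> chains K n"
  shows "(\<lambda>xs. c xs + d xs) \<in> chains K n"
  using assms unfolding chains_def by (auto simp: bounded_fun_add) (metis add_0)+

lemma chains_mono: "K \<subseteq> K' \<Longrightarrow> chains K n \<subseteq> chains K' n"
  unfolding chains_def by blast

lemma boundaries_mono: "K \<subseteq> K' \<Longrightarrow> boundaries K n \<subseteq> boundaries K' n"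
  unfolding boundaries_def by (intro image_mono chains_mono)

lemma chains_nonzeroD:
  "c \<in> chains K n \<Longrightarrow> c xs \<noteq> 0 \<Longrightarrow> length xs = Suc n \<and> distinct xs \<and> set xs \<in> K"
  unfolding chains_def by blast

lemma chains_swap:
  "c \<in> chains K n \<Longrightarrow> i < j \<Longrightarrow> j < length xs \<Longrightarrow> c (xs[i := xs ! j, j := xs ! i]) = - c xs"
  unfolding chains_def by blast

lemma chains_swap_hd:
  assumes "c \<in> chains K n"
  shows "c (y # x # ys) = - c (x # y # ys)"
  using chains_swap[OF assms, of 0 1 "x # y # ys"] by simp

text \<open>\<open>bdry\<close> sums over the support, which varies with the chain; a fixed finite
  superset makes the boundaries of different chains comparable.\<close>

lemma bdry_eq_sum:
  assumes "finite X" "{x. c (x # ys) \<noteq> 0} \<subseteq> X" "ys \<noteq> []"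
  shows "bdry c ys = (\<Sum>x\<in>X. c (x # ys))"
  using assms unfolding bdry_def by (auto intro!: sum.mono_neutral_left)

lemma bdry_zero: "bdry (\<lambda>xs. 0) = (\<lambda>ys. 0)"
  unfolding bdry_def by auto

lemma bdry_minus: "bdry (\<lambda>xs. - c xs) = (\<lambda>ys. - bdry c ys)"
  unfolding bdry_def by (auto simp: sum_negf)

text \<open>Shared by the graph and by all its Rips complexes. The bound on the number of vertices
  near \<open>v\<close> is uniform, since the boundary of a bounded chain has to be bounded
  again.\<close>

locale bounded_complex =
  fixes K :: "'v set set"
  assumes face: "s \<in> K \<Longrightarrow> t \<subseteq> s \<Longrightarrow> t \<noteq> {} \<Longrightarrow> t \<in> K"
    and bounded_geometry: "\<exists>N. \<forall>v. finite (\<Union>{s \<in> K. v \<in> s}) \<and> card (\<Union>{s \<in> K. v \<in> s}) \<le> N"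
begin

definition star :: "'v \<Rightarrow> 'v set" where
  "star v = \<Union>{s \<in> K. v \<in> s}"

lemma finite_star: "finite (star v)"
  using bounded_geometry unfolding star_def by blast

lemma chain_support_star:
  assumes "c \<in> chains K n" "c xs \<noteq> 0" "x \<in> set xs" "y \<in> set xs"
  shows "x \<in> star y"
  using chains_nonzeroD[OF assms(1,2)] assms unfolding star_def by blast

lemma bdry_star:
  assumes "c \<in> chains K n" "ys \<noteq> []"
  shows "bdry c ys = (\<Sum>x\<in>star (hd ys). c (x # ys))"
  by (rule bdry_eq_sum) (use assms in \<open>auto intro: finite_star chain_support_star[where xs = "_ # ys"]\<close>)

lemma bdry_add:
  fixes c d :: "'v list \<Rightarrow> 'a::normed_coeff_ring"
  assumes "c \<in> chains K n" "d \<in> chains K n"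
  shows "bdry (\<lambda>xs. c xs + d xs) = (\<lambda>ys. bdry c ys + bdry d ys)"
proof
  fix ys
  show "bdry (\<lambda>xs. c xs + d xs) ys = bdry c ys + bdry d ys"
  proof (cases "ys = []")
    case False
    then show ?thesis
      using bdry_star[OF assms(1)] bdry_star[OF assms(2)] bdry_star[OF chains_add[OF assms]]
      by (simp add: sum.distrib)
  qed (simp add: bdry_def)
qed

lemma bdry_chain:
  fixes c :: "'v list \<Rightarrow> 'a::normed_coeff_ring"
  assumes c: "c \<in> chains K (Suc n)"
  shows "bdry c \<in> chains K n"
proof -
  obtain M where M: "M \<ge> 0" "\<And>xs. cnorm (c xs) \<le> M"
    using c bounded_fun_pos unfolding chains_def by blast
  obtain N where N: "\<And>v. card (star v) \<le> N" using bounded_geometry unfolding star_def by blast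
  have "cnorm (bdry c ys) \<le> real N * M" for ys
  proof (cases "ys = []")
    case False
    have "cnorm (bdry c ys) \<le> (\<Sum>x\<in>star (hd ys). cnorm (c (x # ys)))"
      unfolding bdry_star[OF c False] by (rule cnorm_sum)
    also have "\<dots> \<le> real (card (star (hd ys))) * M" using M by (intro sum_bounded_above) auto
    also have "\<dots> \<le> real N * M" using N M by (intro mult_right_mono) auto
    finally show ?thesis .
  qed (use M in \<open>simp add: bdry_def\<close>)
  then have "bounded_fun (bdry c)" unfolding bounded_fun_def by blast
  moreover have "length ys = Suc n \<and> distinct ys \<and> set ys \<in> K" if nz: "bdry c ys \<noteq> 0" for ys
  proof -
    have ne: "ys \<noteq> []" using nz unfolding bdry_def by auto
    then obtain x where "c (x # ys) \<noteq> 0"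
      using nz unfolding bdry_star[OF c ne] by (meson sum.not_neutral_contains_not_neutral)
    then show ?thesis using chains_nonzeroD[OF c, of "x # ys"] face[of "insert x (set ys)" "set ys"] ne
      by auto
  qed
  moreover have "bdry c (ys[i := ys ! j, j := ys ! i]) = - bdry c ys" if ij: "i < j" "j < length ys" for ys i j
  proof -
    have "c (x # ys[i := ys ! j, j := ys ! i]) = - c (x # ys)" for x
      using chains_swap[OF c, of "Suc i" "Suc j" "x # ys"] ij by simp
    then show ?thesis using ij unfolding bdry_def by (auto simp: sum_negf)
  qed
  ultimately show ?thesis unfolding chains_def by blast
qed

lemma bdry_bdry:
  fixes c :: "'v list \<Rightarrow> 'a::normed_coeff_ring"
  assumes c: "c \<in> chains K (Suc n)"
  shows "bdry (bdry c) = (\<lambda>ys. 0)"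
proof
  fix ys
  show "bdry (bdry c) ys = 0"
  proof (cases "ys = []")
    case False
    \<comment> \<open>All vertices of a simplex through \<open>hd ys\<close> lie in this star, so
      both indices run over the same finite set and the double sum is antisymmetric.\<close>
    let ?X = "star (hd ys)"
    have "bdry c (y # ys) = (\<Sum>x\<in>?X. c (x # y # ys))" for y
      by (rule bdry_eq_sum) (use False in \<open>auto intro: finite_star chain_support_star[OF c]\<close>)
    then have "bdry (bdry c) ys = (\<Sum>y\<in>?X. \<Sum>x\<in>?X. c (x # y # ys))"
      unfolding bdry_star[OF bdry_chain[OF c] False] by simp
    also have "\<dots> = 0"
      using chains_nonzeroD[OF c]
      by (intro sum_antisymmetric_eq_0 finite_star chains_swap_hd[OF c]) fastforce
    finally show ?thesis .
  qed (simp add: bdry_def)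
qed

section \<open>Homology groups of a complex of bounded geometry\<close>

lemma cycles_zero: "(\<lambda>xs. 0 :: 'a::normed_coeff_ring) \<in> cycles K n"
  unfolding cycles_def by (auto simp: chains_zero bdry_zero)

lemma cycles_add:
  fixes c d :: "'v list \<Rightarrow> 'a::normed_coeff_ring"
  shows "c \<in> cycles K n \<Longrightarrow> d \<in> cycles K n \<Longrightarrow> (\<lambda>xs. c xs + d xs) \<in> cycles K n"
  unfolding cycles_def by (auto simp: chains_add bdry_add)

lemma cycles_minus:
  fixes c :: "'v list \<Rightarrow> 'a::normed_coeff_ring"
  shows "c \<in> cycles K n \<Longrightarrow> (\<lambda>xs. - c xs) \<in> cycles K n"
  unfolding cycles_def by (auto simp: chains_minus bdry_minus)

lemma cycles_diff:
  fixes c d :: "'v list \<Rightarrow> 'a::normed_coeff_ring"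
  shows "c \<in> cycles K n \<Longrightarrow> d \<in> cycles K n \<Longrightarrow> (\<lambda>xs. c xs - d xs) \<in> cycles K n"
  using cycles_add[OF _ cycles_minus, of c n d] by simp

lemma boundaries_subset_cycles: "boundaries K n \<subseteq> (cycles K n :: ('v list \<Rightarrow> 'a::normed_coeff_ring) set)"
  unfolding boundaries_def cycles_def using bdry_chain bdry_bdry by blast

lemma boundaries_zero: "(\<lambda>xs. 0 :: 'a::normed_coeff_ring) \<in> boundaries K n"
  unfolding boundaries_def by (rule image_eqI[OF _ chains_zero]) (simp add: bdry_zero)

lemma boundaries_minus:
  fixes c :: "'v list \<Rightarrow> 'a::normed_coeff_ring"
  shows "c \<in> boundaries K n \<Longrightarrow> (\<lambda>xs. - c xs) \<in> boundaries K n"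
  unfolding boundaries_def by (auto simp: bdry_minus[symmetric] intro!: imageI chains_minus)

lemma boundaries_add:
  fixes c d :: "'v list \<Rightarrow> 'a::normed_coeff_ring"
  assumes "c \<in> boundaries K n" "d \<in> boundaries K n"
  shows "(\<lambda>xs. c xs + d xs) \<in> boundaries K n"
proof -
  obtain c' d' where "c' \<in> chains K (Suc n)" "d' \<in> chains K (Suc n)" "c = bdry c'" "d = bdry d'"
    using assms unfolding boundaries_def by blast
  then show ?thesis unfolding boundaries_def
    by (auto simp: bdry_add[symmetric] intro!: imageI chains_add)
qed

lemma comm_group_cycles: "comm_group (fun_group (cycles K n :: ('v list \<Rightarrow> 'a::normed_coeff_ring) set))"
  by (intro comm_group_fun_group cycles_zero cycles_add cycles_minus)

lemma boundaries_normal: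
  "boundaries K n \<lhd> fun_group (cycles K n :: ('v list \<Rightarrow> 'a::normed_coeff_ring) set)"
proof -
  let ?G = "fun_group (cycles K n :: ('v list \<Rightarrow> 'a) set)"
  interpret comm_group ?G by (rule comm_group_cycles)
  have inv: "inv\<^bsub>?G\<^esub> c = (\<lambda>xs. - c xs)" if "c \<in> cycles K n" for c
    by (rule inv_equality) (use that in \<open>auto simp: fun_group_def cycles_minus\<close>)
  have "subgroup (boundaries K n) ?G"
  proof (rule subgroupI)
    show "inv\<^bsub>?G\<^esub> c \<in> boundaries K n" if "c \<in> boundaries K n" for c
      using that inv boundaries_subset_cycles boundaries_minus by (metis subsetD)
    show "boundaries K n \<noteq> ({} :: ('v list \<Rightarrow> 'a) set)" using boundaries_zero by blast
  qed (use boundaries_subset_cycles boundaries_add in \<open>auto simp: fun_group_def\<close>)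
  then show ?thesis using normal_iff_subgroup by blast
qed

lemma hclass_eq: "hclass K n z = (\<lambda>b xs. b xs + z xs) ` boundaries K n"
  unfolding hclass_def r_coset_def fun_group_def by auto

lemma hclass_eq_iff:
  fixes z z' :: "'v list \<Rightarrow> 'a::normed_coeff_ring"
  shows "hclass K n z = hclass K n z' \<longleftrightarrow> (\<lambda>xs. z xs - z' xs) \<in> boundaries K n"
proof
  assume "hclass K n z = hclass K n z'"
  moreover have "z \<in> hclass K n z" unfolding hclass_eq by (rule image_eqI[OF _ boundaries_zero]) simp
  ultimately obtain b where b: "b \<in> boundaries K n" "z = (\<lambda>xs. b xs + z' xs)" unfolding hclass_eq by blast
  then have "(\<lambda>xs. z xs - z' xs) = b" by auto
  then show "(\<lambda>xs. z xs - z' xs) \<in> boundaries K n" using b by simp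
next
  have *: "hclass K n z \<subseteq> hclass K n z'" if d: "(\<lambda>xs. z xs - z' xs) \<in> boundaries K n"
    for z z' :: "'v list \<Rightarrow> 'a"
  proof
    fix x assume "x \<in> hclass K n z"
    then obtain b where b: "b \<in> boundaries K n" "x = (\<lambda>xs. b xs + z xs)" unfolding hclass_eq by blast
    then have "x = (\<lambda>xs. (b xs + (z xs - z' xs)) + z' xs)" by auto
    then show "x \<in> hclass K n z'" using boundaries_add[OF b(1) d] unfolding hclass_eq by (rule image_eqI)
  qed
  assume d: "(\<lambda>xs. z xs - z' xs) \<in> boundaries K n"
  then have "(\<lambda>xs. z' xs - z xs) \<in> boundaries K n" using boundaries_minus[OF d] by simp
  with d show "hclass K n z = hclass K n z'" using * by blast
qed

lemma carrier_H_suf: "carrier (H_suf K n) = hclass K n ` cycles K n"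
  unfolding H_suf_def hclass_def FactGroup_def RCOSETS_def fun_group_def by auto

lemma H_suf_mult:
  fixes z z' :: "'v list \<Rightarrow> 'a::normed_coeff_ring"
  assumes "z \<in> cycles K n" "z' \<in> cycles K n"
  shows "hclass K n z \<otimes>\<^bsub>H_suf K n\<^esub> hclass K n z' = hclass K n (\<lambda>xs. z xs + z' xs)"
proof -
  interpret normal "boundaries K n" "fun_group (cycles K n :: ('v list \<Rightarrow> 'a) set)"
    by (rule boundaries_normal)
  show ?thesis
    using rcos_sum[of z z'] assms unfolding hclass_def H_suf_def FactGroup_def
    by (simp add: fun_group_def)
qed

end

text \<open>The union over a class is a single class, since boundaries in the smaller complex stay
  boundaries in the larger one. On representatives every transition map is thus the
  identity.\<close>

lemma incl_map_hclass:
  fixes z :: "'v list \<Rightarrow> 'a::normed_coeff_ring"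
  assumes "bounded_complex K" "bounded_complex K'" "K \<subseteq> K'"
  shows "incl_map K' n (hclass K n z) = hclass K' n z"
proof -
  interpret K: bounded_complex K by fact
  interpret K': bounded_complex K' by fact
  have "hclass K' n (\<lambda>xs. b xs + z xs) = hclass K' n z" if "b \<in> boundaries K n" for b
    using that boundaries_mono[OF assms(3)] unfolding K'.hclass_eq_iff by auto
  then show ?thesis
    using K.boundaries_zero[where 'a = 'a, of n] unfolding incl_map_def K.hclass_eq by auto
qed

lemma cycles_mono: "K \<subseteq> K' \<Longrightarrow> cycles K n \<subseteq> cycles K' n"
  unfolding cycles_def using chains_mono by blast

lemma incl_map_hom:
  assumes "bounded_complex K" "bounded_complex K'" "K \<subseteq> K'"
  shows "incl_map K' n \<in>
    hom (H_suf K n :: ('v list \<Rightarrow> 'a::normed_coeff_ring) set monoid) (H_suf K' n)"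
proof (rule homI)
  interpret K: bounded_complex K by fact
  interpret K': bounded_complex K' by fact
  note incl = incl_map_hclass[OF assms, of n]
  have cyc: "cycles K n \<subseteq> (cycles K' n :: ('v list \<Rightarrow> 'a) set)" by (rule cycles_mono[OF assms(3)])
  fix X :: "('v list \<Rightarrow> 'a) set" assume "X \<in> carrier (H_suf K n)"
  then obtain x where x: "x \<in> cycles K n" "X = hclass K n x" unfolding K.carrier_H_suf by blast
  then show "incl_map K' n X \<in> carrier (H_suf K' n)"
    unfolding K'.carrier_H_suf x(2) incl using cyc by blast
  fix Y :: "('v list \<Rightarrow> 'a) set" assume "Y \<in> carrier (H_suf K n)"
  then obtain y where y: "y \<in> cycles K n" "Y = hclass K n y" unfolding K.carrier_H_suf by blast
  show "incl_map K' n (X \<otimes>\<^bsub>H_suf K n\<^esub> Y) = incl_map K' n X \<otimes>\<^bsub>H_suf K' n\<^esub> incl_map K' n Y"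
    unfolding x(2) y(2) K.H_suf_mult[OF x(1) y(1)] incl
    using K'.H_suf_mult[of x n y] x(1) y(1) cyc by auto
qed

section \<open>Direct limits\<close>

locale direct_system =
  fixes G :: "nat \<Rightarrow> 'g monoid" and \<phi> :: "nat \<Rightarrow> nat \<Rightarrow> 'g \<Rightarrow> 'g"
  assumes mult_closed: "a \<in> carrier (G m) \<Longrightarrow> b \<in> carrier (G m) \<Longrightarrow> a \<otimes>\<^bsub>G m\<^esub> b \<in> carrier (G m)"
    and trans_hom: "m \<le> n \<Longrightarrow> \<phi> m n \<in> hom (G m) (G n)"
    and trans_comp: "k \<le> m \<Longrightarrow> m \<le> n \<Longrightarrow> a \<in> carrier (G k) \<Longrightarrow> \<phi> m n (\<phi> k m a) = \<phi> k n a"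
begin

abbreviation rel :: "((nat \<times> 'g) \<times> (nat \<times> 'g)) set" where
  "rel \<equiv> dirlim_rel G \<phi>"

lemma trans_closed: "m \<le> n \<Longrightarrow> a \<in> carrier (G m) \<Longrightarrow> \<phi> m n a \<in> carrier (G n)"
  using trans_hom hom_in_carrier by metis

lemma trans_mult:
  "m \<le> n \<Longrightarrow> a \<in> carrier (G m) \<Longrightarrow> b \<in> carrier (G m) \<Longrightarrow>
    \<phi> m n (a \<otimes>\<^bsub>G m\<^esub> b) = \<phi> m n a \<otimes>\<^bsub>G n\<^esub> \<phi> m n b"
  using trans_hom hom_mult by metis

lemma rel_iff: "((m, a), (n, b)) \<in> rel \<longleftrightarrow> a \<in> carrier (G m) \<and> b \<in> carrier (G n) \<and>
     (\<exists>k. m \<le> k \<and> n \<le> k \<and> \<phi> m k a = \<phi> n k b)"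
  unfolding dirlim_rel_def by auto

lemma equiv_rel: "equiv (SIGMA m:UNIV. carrier (G m)) rel"
proof (rule equivI)
  show "rel \<subseteq> (SIGMA m:UNIV. carrier (G m)) \<times> (SIGMA m:UNIV. carrier (G m))"
    by (auto simp: rel_iff)
  show "refl_on (SIGMA m:UNIV. carrier (G m)) rel"
    by (auto simp: refl_on_def rel_iff)
  show "sym rel" by (auto simp: sym_def rel_iff)
  show "trans rel"
  proof (rule transI)
    fix x y z assume "(x, y) \<in> rel" "(y, z) \<in> rel"
    moreover obtain m a n b p c where xyz: "x = (m, a)" "y = (n, b)" "z = (p, c)"
      by (meson surj_pair)
    ultimately obtain k l where kl: "m \<le> k" "n \<le> k" "n \<le> l" "p \<le> l"
      "\<phi> m k a = \<phi> n k b" "\<phi> n l b = \<phi> p l c"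
      and car: "a \<in> carrier (G m)" "b \<in> carrier (G n)" "c \<in> carrier (G p)"
      by (auto simp: rel_iff)
    \<comment> \<open>Both witnesses are transported to a common later index, where the two images
      of \<open>b\<close> coincide.\<close>
    let ?q = "max k l"
    have "\<phi> m ?q a = \<phi> k ?q (\<phi> m k a)" using kl car trans_comp[of m k ?q a] by simp
    also have "\<dots> = \<phi> l ?q (\<phi> n l b)"
      using kl car trans_comp[of n k ?q b] trans_comp[of n l ?q b] by simp
    also have "\<dots> = \<phi> p ?q c" using kl car trans_comp[of p l ?q c] by simp
    finally show "(x, z) \<in> rel" using xyz kl car by (auto simp: rel_iff intro!: exI[of _ ?q])
  qed
qed

lemma class_eq_iff:
  assumes "a \<in> carrier (G m)" "b \<in> carrier (G n)"
  shows "rel `` {(m, a)} = rel `` {(n, b)} \<longleftrightarrow> (\<exists>k. m \<le> k \<and> n \<le> k \<and> \<phi> m k a = \<phi> n k b)"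
  using eq_equiv_class_iff[OF equiv_rel, of "(m, a)" "(n, b)"] assms by (auto simp: rel_iff)

lemma dirlim_mult:
  assumes "a \<in> carrier (G m)" "b \<in> carrier (G n)"
  shows "rel `` {(m, a)} \<otimes>\<^bsub>dirlim G \<phi>\<^esub> rel `` {(n, b)} =
    rel `` {(max m n, \<phi> m (max m n) a \<otimes>\<^bsub>G (max m n)\<^esub> \<phi> n (max m n) b)}" (is "_ = ?R")
proof -
  \<comment> \<open>The product is a union over all representatives; it collapses once every pair
    contributes the same class. The two products are compared at \<open>q\<close>, beyond the
    witnesses \<open>k\<close> and \<open>l\<close>.\<close>
  have *: "rel `` {(max m' n', \<phi> m' (max m' n') a' \<otimes>\<^bsub>G (max m' n')\<^esub> \<phi> n' (max m' n') b')} = ?R"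
    if rels: "((m, a), (m', a')) \<in> rel" "((n, b), (n', b')) \<in> rel" for m' n' a' b'
  proof -
    obtain k l where kl: "m \<le> k" "m' \<le> k" "\<phi> m k a = \<phi> m' k a'"
       "n \<le> l" "n' \<le> l" "\<phi> n l b = \<phi> n' l b'" and car: "a' \<in> carrier (G m')" "b' \<in> carrier (G n')"
      using rels by (auto simp: rel_iff)
    define q s s' where "q = max k l" and "s = max m n" and "s' = max m' n'"
    then have le: "k \<le> q" "l \<le> q" "m \<le> s" "n \<le> s" "s \<le> q" "m' \<le> s'" "n' \<le> s'" "s' \<le> q"
      using kl by auto
    have "\<phi> s' q (\<phi> m' s' a' \<otimes>\<^bsub>G s'\<^esub> \<phi> n' s' b') = \<phi> m' q a' \<otimes>\<^bsub>G q\<^esub> \<phi> n' q b'"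
      using le car by (simp add: trans_mult trans_closed trans_comp)
    moreover have "\<phi> m' q a' = \<phi> m q a"
      using kl le car assms trans_comp[of m k q a] trans_comp[of m' k q a'] by simp
    moreover have "\<phi> n' q b' = \<phi> n q b"
      using kl le car assms trans_comp[of n l q b] trans_comp[of n' l q b'] by simp
    moreover have "\<phi> s q (\<phi> m s a \<otimes>\<^bsub>G s\<^esub> \<phi> n s b) = \<phi> m q a \<otimes>\<^bsub>G q\<^esub> \<phi> n q b"
      using le assms by (simp add: trans_mult trans_closed trans_comp)
    ultimately show ?thesis using le car assms unfolding s_def[symmetric] s'_def[symmetric]
      by (subst class_eq_iff) (auto simp: mult_closed trans_closed intro!: exI[of _ q])
  qed
  have reps: "(m, a) \<in> rel `` {(m, a)}" "(n, b) \<in> rel `` {(n, b)}"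
    using assms by (auto simp: rel_iff)
  have "rel `` {(m, a)} \<otimes>\<^bsub>dirlim G \<phi>\<^esub> rel `` {(n, b)} =
    (\<Union>(m', a')\<in>rel `` {(m, a)}. \<Union>(n', b')\<in>rel `` {(n, b)}. ?R)"
    unfolding dirlim_def monoid.simps Let_def
    by (intro SUP_cong prod.case_cong refl, rule *) auto
  also have "\<dots> = ?R" using reps by auto
  finally show ?thesis .
qed

text \<open>Elements of the limit are equal when they agree at some later index. So injectivity of
  \<open>h\<close> has to survive every transition, while surjectivity is asked for only after some
  transition.\<close>

lemma iso_dirlim:
  assumes h: "h \<in> hom H (G p)"
    and inj: "\<And>x y k. x \<in> carrier H \<Longrightarrow> y \<in> carrier H \<Longrightarrow> p \<le> k \<Longrightarrow> \<phi> p k (h x) = \<phi> p k (h y) \<Longrightarrow> x = y"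
    and surj: "\<And>m a. a \<in> carrier (G m) \<Longrightarrow> \<exists>x\<in>carrier H. \<exists>k. p \<le> k \<and> m \<le> k \<and> \<phi> p k (h x) = \<phi> m k a"
  shows "(\<lambda>x. rel `` {(p, h x)}) \<in> iso H (dirlim G \<phi>)"
proof (rule isoI)
  have hc: "h x \<in> carrier (G p)" if "x \<in> carrier H" for x using h that hom_in_carrier by metis
  show "(\<lambda>x. rel `` {(p, h x)}) \<in> hom H (dirlim G \<phi>)"
  proof (rule homI)
    fix x assume "x \<in> carrier H"
    then show "rel `` {(p, h x)} \<in> carrier (dirlim G \<phi>)"
      using hc[of x] unfolding dirlim_def by (auto intro: quotientI)
  next
    fix x y assume xy: "x \<in> carrier H" "y \<in> carrier H"
    \<comment> \<open>The product in the limit applies \<open>\<phi> p (max p p)\<close> to both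
      factors. Nothing says that \<open>\<phi> p p\<close> is the identity, but
      \<open>trans_comp\<close> makes it idempotent, so the class does not change.\<close>
    have "rel `` {(p, h (x \<otimes>\<^bsub>H\<^esub> y))} = rel `` {(p, \<phi> p p (h x \<otimes>\<^bsub>G p\<^esub> h y))}"
      using xy hc hom_mult[OF h]
      by (subst class_eq_iff) (auto simp: mult_closed trans_closed trans_comp intro!: exI[of _ p])
    also have "\<dots> = rel `` {(p, h x)} \<otimes>\<^bsub>dirlim G \<phi>\<^esub> rel `` {(p, h y)}"
      using xy hc by (subst dirlim_mult) (auto simp: trans_mult)
    finally show "rel `` {(p, h (x \<otimes>\<^bsub>H\<^esub> y))} = rel `` {(p, h x)} \<otimes>\<^bsub>dirlim G \<phi>\<^esub> rel `` {(p, h y)}" .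
  qed
  show "bij_betw (\<lambda>x. rel `` {(p, h x)}) (carrier H) (carrier (dirlim G \<phi>))"
  proof (rule bij_betw_imageI)
    show "inj_on (\<lambda>x. rel `` {(p, h x)}) (carrier H)"
      using class_eq_iff inj hc unfolding inj_on_def by metis
    show "(\<lambda>x. rel `` {(p, h x)}) ` carrier H = carrier (dirlim G \<phi>)"
    proof (intro equalityI subsetI)
      fix X assume "X \<in> (\<lambda>x. rel `` {(p, h x)}) ` carrier H"
      then show "X \<in> carrier (dirlim G \<phi>)" using hc unfolding dirlim_def by (auto intro: quotientI)
    next
      fix X assume "X \<in> carrier (dirlim G \<phi>)"
      then obtain m a where a: "a \<in> carrier (G m)" "X = rel `` {(m, a)}"
        unfolding dirlim_def by (auto elim!: quotientE)
      then obtain x k where "x \<in> carrier H" "p \<le> k \<and> m \<le> k \<and> \<phi> p k (h x) = \<phi> m k a"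
        using surj by blast
      then have "X = rel `` {(p, h x)}" using a class_eq_iff hc by metis
      then show "X \<in> (\<lambda>x. rel `` {(p, h x)}) ` carrier H" using \<open>x \<in> carrier H\<close> by blast
    qed
  qed
qed

end

section \<open>Trivalent trees\<close>

text \<open>A list of length 2 has a single transposition. Swapping entries preserves the length, so
  on all other lists both sides of the alternation rule are zero.\<close>

lemma chains_1I:
  assumes "bounded_fun c" "\<And>xs. c xs \<noteq> 0 \<Longrightarrow> \<exists>x y. xs = [x, y] \<and> x \<noteq> y \<and> {x, y} \<in> K"
    and "\<And>x y. c [y, x] = - c [x, y]"
  shows "c \<in> chains K 1"
proof -
  have "c (xs[i := xs ! j, j := xs ! i]) = - c xs" if ij: "i < j" "j < length xs" for xs i j
  proof (cases "length xs = 2")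
    case True
    then obtain x y where "xs = [x, y]" by (auto simp: numeral_2_eq_2 length_Suc_conv)
    moreover have "i = 0" "j = 1" using ij True by auto
    ultimately show ?thesis using assms(3)[of y x] by simp
  next
    case False
    have "c ys = 0" if "length ys \<noteq> 2" for ys
      using that by (rule contrapos_np) (auto dest: assms(2))
    with False have "c xs = 0" "c (xs[i := xs ! j, j := xs ! i]) = 0" by auto
    then show ?thesis by simp
  qed
  moreover have "length xs = Suc 1 \<and> distinct xs \<and> set xs \<in> K" if "c xs \<noteq> 0" for xs
    using assms(2)[OF that] by auto
  ultimately show ?thesis using assms(1) unfolding chains_def by blast
qed

lemma chains_1D:
  assumes "c \<in> chains K 1" "c xs \<noteq> 0"
  shows "\<exists>x y. xs = [x, y] \<and> x \<noteq> y \<and> {x, y} \<in> K"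
  using chains_nonzeroD[OF assms] by (auto simp: length_Suc_conv)

lemma chains_1_antisym: "c \<in> chains K 1 \<Longrightarrow> c [y, x] = - c [x, y]"
  by (rule chains_swap_hd)

locale trivalent_graph =
  fixes V :: "'v set" and E :: "'v set set"
  assumes trivalent: "trivalent_tree V E"
begin

abbreviation T :: "'v set set" where
  "T \<equiv> graph_complex V E"

definition nbrs :: "'v \<Rightarrow> 'v set" where
  "nbrs v = {x. {x, v} \<in> E}"

lemma edge_obtain:
  assumes "e \<in> E"
  obtains x y where "e = {x, y}" "x \<noteq> y" "x \<in> V" "y \<in> V"
proof -
  have "simple_graph V E" using trivalent unfolding trivalent_tree_def tree_def by simp
  then show ?thesis using that assms unfolding simple_graph_def by metis
qed

lemma edgeD: "{x, y} \<in> E \<Longrightarrow> x \<noteq> y \<and> x \<in> V \<and> y \<in> V"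
  by (rule edge_obtain[of "{x, y}"]) (auto simp: doubleton_eq_iff)

lemma nbrs_bounded: "finite (nbrs v) \<and> card (nbrs v) \<le> 3"
proof (cases "v \<in> V")
  case True
  let ?D = "{e \<in> E. v \<in> e}"
  have "vdegree E v \<in> {2, 3}" using trivalent True unfolding trivalent_tree_def by blast
  \<comment> \<open>An infinite set has cardinality 0, so a degree of 2 or 3 gives finiteness as
    well.\<close>
  then have D: "finite ?D" "card ?D \<le> 3" unfolding vdegree_def by (auto intro: card_ge_0_finite)
  have inj: "inj_on (\<lambda>x. {x, v}) (nbrs v)" by (auto simp: inj_on_def doubleton_eq_iff)
  have sub: "(\<lambda>x. {x, v}) ` nbrs v \<subseteq> ?D" unfolding nbrs_def by auto
  show ?thesis
    using inj_on_finite[OF inj sub D(1)] card_inj_on_le[OF inj sub D(1)] D(2) by linarith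
next
  case False
  then have "nbrs v = {}" using edgeD unfolding nbrs_def by blast
  then show ?thesis by simp
qed

lemma graph_complex_card: "s \<in> T \<Longrightarrow> card s \<le> 2"
  unfolding graph_complex_def by (auto elim!: edge_obtain)

lemma edge_graph_complex: "x \<noteq> y \<Longrightarrow> {x, y} \<in> T \<longleftrightarrow> {x, y} \<in> E"
  unfolding graph_complex_def by auto

lemma bounded_complex_graph: "bounded_complex T"
proof
  fix s t assume "s \<in> T" and t: "t \<subseteq> s" "t \<noteq> {}"
  then have "(\<exists>v\<in>V. s = {v}) \<or> s \<in> E" unfolding graph_complex_def by auto
  then consider v where "s = {v}" "v \<in> V" | x y where "s = {x, y}" "s \<in> E" "x \<in> V" "y \<in> V"
    by (metis edge_obtain)
  then show "t \<in> T"
  proof cases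
    case (1 v)
    then have "t = {v}" using t by auto
    then show ?thesis using 1 unfolding graph_complex_def by auto
  next
    case (2 x y)
    then have "t = {x} \<or> t = {y} \<or> t = s" using t by auto
    then show ?thesis using 2 unfolding graph_complex_def by auto
  qed
next
  \<comment> \<open>The 4 counts \<open>v\<close> and its at most three neighbours.\<close>
  have "finite (\<Union>{s \<in> T. v \<in> s}) \<and> card (\<Union>{s \<in> T. v \<in> s}) \<le> 4" for v
  proof -
    have sub: "\<Union>{s \<in> T. v \<in> s} \<subseteq> insert v (nbrs v)"
    proof
      fix x assume "x \<in> \<Union>{s \<in> T. v \<in> s}"
      then obtain s where s: "s \<in> T" "x \<in> s" "v \<in> s" by blast
      show "x \<in> insert v (nbrs v)"
      proof (cases "x = v")
        case False
        then have "s = {x, v}" using s unfolding graph_complex_def by (auto elim!: edge_obtain)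
        then show ?thesis using s False edge_graph_complex unfolding nbrs_def by simp
      qed simp
    qed
    moreover have "finite (insert v (nbrs v))" "card (insert v (nbrs v)) \<le> 4"
      using nbrs_bounded[of v] by (auto simp: card_insert_if)
    ultimately show ?thesis by (meson card_mono finite_subset order_trans)
  qed
  then show "\<exists>N. \<forall>v. finite (\<Union>{s \<in> T. v \<in> s}) \<and> card (\<Union>{s \<in> T. v \<in> s}) \<le> N" by blast
qed

sublocale graph: bounded_complex T
  by (rule bounded_complex_graph)

lemma boundaries_graph: "boundaries T 1 = {\<lambda>xs. 0 :: 'a::normed_coeff_ring}"
proof -
  have "c = (\<lambda>xs. 0)" if c: "c \<in> chains T (Suc 1)" for c :: "'v list \<Rightarrow> 'a"
  proof
    fix xs
    show "c xs = 0"
    proof (rule ccontr)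
      assume "c xs \<noteq> 0"
      then have "card (set xs) = 3 \<and> set xs \<in> T"
        using chains_nonzeroD[OF c] distinct_card by fastforce
      then show False using graph_complex_card by fastforce
    qed
  qed
  then have "chains T (Suc 1) = {\<lambda>xs. 0 :: 'a}" using chains_zero by blast
  then show ?thesis unfolding boundaries_def by (simp add: bdry_zero)
qed

text \<open>Since classes are singletons, the quotient norm of a class is the sup norm of its only
  flow, and the elements of the homology group can be identified with flows.\<close>

lemma hclass_graph: "hclass T 1 z = {z :: 'v list \<Rightarrow> 'a::normed_coeff_ring}"
  unfolding graph.hclass_eq boundaries_graph by simp

lemma graph_chain_edge: "c \<in> chains T 1 \<Longrightarrow> c [x, y] \<noteq> 0 \<Longrightarrow> {x, y} \<in> E"
  using chains_1D[of c T "[x, y]"] edge_graph_complex by auto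

lemma bdry_graph:
  fixes c :: "'v list \<Rightarrow> 'a::normed_coeff_ring"
  assumes c: "c \<in> chains T 1"
  shows "bdry c ys = (case ys of [y] \<Rightarrow> (\<Sum>x\<in>nbrs y. c [x, y]) | _ \<Rightarrow> 0)"
proof (cases "\<exists>y. ys = [y]")
  case True
  then obtain y where y: "ys = [y]" by blast
  have "bdry c [y] = (\<Sum>x\<in>nbrs y. c [x, y])"
    by (rule bdry_eq_sum)
      (use nbrs_bounded graph_chain_edge[OF c] in \<open>auto simp: nbrs_def\<close>)
  then show ?thesis using y by simp
next
  case False
  then have "c (x # ys) = 0" for x using chains_1D[OF c, of "x # ys"] by auto
  then have "bdry c ys = 0" unfolding bdry_def by simp
  then show ?thesis using False by (auto split: list.split)
qed

lemma cycles_graph_iff: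
  fixes c :: "'v list \<Rightarrow> 'a::normed_coeff_ring"
  shows "c \<in> cycles T 1 \<longleftrightarrow> c \<in> chains T 1 \<and> (\<forall>y. (\<Sum>x\<in>nbrs y. c [x, y]) = 0)"
proof (cases "c \<in> chains T 1")
  case True
  have "bdry c = (\<lambda>ys. 0) \<longleftrightarrow> (\<forall>y. (\<Sum>x\<in>nbrs y. c [x, y]) = 0)"
    unfolding fun_eq_iff bdry_graph[OF True] by (auto split: list.split)
  then show ?thesis using True unfolding cycles_def by simp
qed (simp add: cycles_def)

end

section \<open>Rips complexes of a trivalent tree\<close>

context trivalent_graph
begin

section \<open>The path metric and its balls\<close>

abbreviation dist :: "'v \<Rightarrow> 'v \<Rightarrow> nat" where
  "dist \<equiv> gdist V E"

text \<open>Walks become powers of this relation, where lengths add under composition and a first or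
  last step can be split off.\<close>

definition adj :: "('v \<times> 'v) set" where
  "adj = {(x, y). {x, y} \<in> E}"

lemma walk_imp_relpow:
  "walk V E xs \<Longrightarrow> (hd xs, last xs) \<in> adj ^^ (length xs - 1)"
proof (induction xs)
  case (Cons x xs)
  show ?case
  proof (cases xs)
    case (Cons y ys)
    then have "walk V E xs" "{x, y} \<in> E" using Cons.prems unfolding walk_def by auto
    then have "(x, y) \<in> adj" "(y, last xs) \<in> adj ^^ length ys"
      using Cons.IH Cons unfolding adj_def by auto
    then have "(x, last xs) \<in> adj ^^ Suc (length ys)" by (rule relpow_Suc_I2)
    then show ?thesis using Cons by simp
  qed simp
qed (simp add: walk_def)

lemma relpow_imp_walk:
  assumes "(x, y) \<in> adj ^^ n" "x \<in> V"
  shows "\<exists>xs. walk V E xs \<and> hd xs = x \<and> last xs = y \<and> length xs = Suc n"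
  using assms
proof (induction n arbitrary: x)
  case 0
  then show ?case by (intro exI[of _ "[x]"]) (auto simp: walk_def)
next
  case (Suc n)
  then obtain z where z: "(x, z) \<in> adj" "(z, y) \<in> adj ^^ n" by (meson relpow_Suc_D2)
  then have "z \<in> V" "{x, z} \<in> E" using edgeD unfolding adj_def by auto
  then obtain xs where xs: "walk V E xs" "hd xs = z" "last xs = y" "length xs = Suc n"
    using Suc.IH z by blast
  then have "walk V E (x # xs)" using \<open>{x, z} \<in> E\<close> Suc.prems unfolding walk_def
    by (auto simp: successively_Cons)
  then show ?case using xs by (intro exI[of _ "x # xs"]) auto
qed

text \<open>The zeroth power relates every point to itself, whereas walks stay inside
  \<open>V\<close>; hence the condition on \<open>x\<close>.\<close>

lemma dist_eq_Least:
  assumes "x \<in> V"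
  shows "dist x y = (LEAST n. (x, y) \<in> adj ^^ n)"
proof -
  have "(\<exists>xs. walk V E xs \<and> hd xs = x \<and> last xs = y \<and> length xs = Suc n) \<longleftrightarrow> (x, y) \<in> adj ^^ n" for n
    using relpow_imp_walk[OF _ assms] walk_imp_relpow by fastforce
  then show ?thesis unfolding gdist_def by simp
qed

lemma dist_relpow:
  assumes "x \<in> V" "y \<in> V"
  shows "(x, y) \<in> adj ^^ dist x y"
proof -
  obtain xs where "walk V E xs" "hd xs = x" "last xs = y"
    using trivalent assms unfolding trivalent_tree_def tree_def by blast
  then have "\<exists>n. (x, y) \<in> adj ^^ n" using walk_imp_relpow by metis
  then show ?thesis unfolding dist_eq_Least[OF assms(1)] by (rule LeastI_ex)
qed

lemma dist_le: "x \<in> V \<Longrightarrow> (x, y) \<in> adj ^^ n \<Longrightarrow> dist x y \<le> n"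
  by (simp add: dist_eq_Least Least_le)

lemma adj_relpow_sym: "(x, y) \<in> adj ^^ n \<Longrightarrow> (y, x) \<in> adj ^^ n"
proof (induction n arbitrary: x)
  case (Suc n)
  then obtain z where z: "(x, z) \<in> adj" "(z, y) \<in> adj ^^ n" by (meson relpow_Suc_D2)
  then have "(z, x) \<in> adj" unfolding adj_def by (simp add: insert_commute)
  then show ?case using Suc.IH[OF z(2)] by (auto intro: relpow_Suc_I)
qed simp

lemma dist_refl: "x \<in> V \<Longrightarrow> dist x x = 0"
  using dist_le[of x x 0] by simp

lemma dist_edge: "{x, y} \<in> E \<Longrightarrow> dist x y \<le> 1"
  using dist_le[of x y 1] edgeD unfolding adj_def by auto

lemma dist_sym: "x \<in> V \<Longrightarrow> y \<in> V \<Longrightarrow> dist x y = dist y x"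
  by (meson adj_relpow_sym dist_le dist_relpow le_antisym)

lemma dist_triangle:
  assumes "x \<in> V" "y \<in> V" "z \<in> V"
  shows "dist x z \<le> dist x y + dist y z"
proof -
  have "(x, z) \<in> adj ^^ (dist x y + dist y z)"
    using dist_relpow[OF assms(1,2)] dist_relpow[OF assms(2,3)] by (auto simp: relpow_add)
  then show ?thesis using dist_le assms by blast
qed

lemma adj_relpow_V: "(x, y) \<in> adj ^^ n \<Longrightarrow> x \<in> V \<Longrightarrow> y \<in> V"
  by (induction n arbitrary: y) (auto simp: adj_def dest: edgeD)

text \<open>The witness is the last vertex but one of a shortest walk. It is at distance at most 1
  from \<open>y\<close>, which is within the smaller scale because \<open>r \<ge> 1\<close>.\<close>

lemma dist_intermediate:
  assumes "x \<in> V" "y \<in> V" "dist x y = Suc r" "r \<ge> 1"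
  obtains m where "m \<in> V" "dist x m \<le> r" "dist m y \<le> r"
proof -
  have "(x, y) \<in> adj ^^ Suc r" using dist_relpow[OF assms(1,2)] assms(3) by simp
  then obtain m where m: "(x, m) \<in> adj ^^ r" "(m, y) \<in> adj" by (meson relpow_Suc_E)
  then have "m \<in> V" using adj_relpow_V assms by blast
  moreover have "dist m y \<le> 1" using dist_edge m unfolding adj_def by blast
  ultimately show ?thesis using that dist_le[OF assms(1) m(1)] assms(4) by force
qed

text \<open>Counted in steps, because \<open>dist\<close> is unspecified outside \<open>V\<close>;
  the cardinality bound then holds for every centre.\<close>

definition vball :: "'v \<Rightarrow> nat \<Rightarrow> 'v set" where
  "vball x r = {y. \<exists>n\<le>r. (x, y) \<in> adj ^^ n}"

lemma vball_bounded: "finite (vball x r) \<and> card (vball x r) \<le> 4 ^ r"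
proof (induction r)
  case (Suc r)
  \<comment> \<open>Each further step multiplies the count by at most 4: a vertex and its up to
    three neighbours.\<close>
  have sub: "vball x (Suc r) \<subseteq> (\<Union>y\<in>vball x r. insert y (nbrs y))"
  proof
    fix y assume "y \<in> vball x (Suc r)"
    then obtain n where n: "n \<le> Suc r" "(x, y) \<in> adj ^^ n" unfolding vball_def by blast
    show "y \<in> (\<Union>y\<in>vball x r. insert y (nbrs y))"
    proof (cases "n \<le> r")
      case True
      then show ?thesis using n unfolding vball_def by blast
    next
      case False
      then have "n = Suc r" using n by simp
      then obtain z where z: "(x, z) \<in> adj ^^ r" "(z, y) \<in> adj" using n by (meson relpow_Suc_E)
      then have "y \<in> nbrs z" unfolding nbrs_def adj_def by (simp add: insert_commute)
      moreover have "z \<in> vball x r" using z unfolding vball_def by blast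
      ultimately show ?thesis by blast
    qed
  qed
  have fin: "finite (\<Union>y\<in>vball x r. insert y (nbrs y))" using Suc nbrs_bounded by auto
  have "card (\<Union>y\<in>vball x r. insert y (nbrs y)) \<le> (\<Sum>y\<in>vball x r. card (insert y (nbrs y)))"
    using Suc by (intro card_UN_le) auto
  also have "\<dots> \<le> (\<Sum>y\<in>vball x r. 4)"
    using nbrs_bounded by (intro sum_mono) (auto simp: card_insert_if intro: le_SucI order_trans)
  also have "\<dots> \<le> 4 ^ Suc r" using Suc by simp
  finally show ?case using card_mono[OF fin sub] finite_subset[OF sub fin] by linarith
qed (auto simp: vball_def)

lemma vball_iff: "x \<in> V \<Longrightarrow> y \<in> V \<Longrightarrow> y \<in> vball x r \<longleftrightarrow> dist x y \<le> r"
  unfolding vball_def using dist_le dist_relpow le_trans by blast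

section \<open>Rips complexes: bounded geometry and scale 1\<close>

abbreviation K :: "nat \<Rightarrow> 'v set set" where
  "K r \<equiv> rips V E r"

lemma bounded_complex_rips: "bounded_complex (K r)"
proof
  fix s t assume "s \<in> K r" "t \<subseteq> s" "t \<noteq> {}"
  then show "t \<in> K r" unfolding rips_def by (auto intro: finite_subset)
next
  have "finite (\<Union>{s \<in> K r. v \<in> s}) \<and> card (\<Union>{s \<in> K r. v \<in> s}) \<le> 4 ^ r" for v
  proof -
    have "\<Union>{s \<in> K r. v \<in> s} \<subseteq> vball v r"
    proof
      fix x assume "x \<in> \<Union>{s \<in> K r. v \<in> s}"
      then have "v \<in> V" "x \<in> V" "dist v x \<le> r" unfolding rips_def by auto
      then show "x \<in> vball v r" using vball_iff by blast
    qed
    then show ?thesis using vball_bounded[of v r] by (meson card_mono finite_subset order_trans)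
  qed
  then show "\<exists>N. \<forall>v. finite (\<Union>{s \<in> K r. v \<in> s}) \<and> card (\<Union>{s \<in> K r. v \<in> s}) \<le> N" by blast
qed

sublocale rips: bounded_complex "K r" for r
  by (rule bounded_complex_rips)

lemma rips_mono: "r \<le> s \<Longrightarrow> K r \<subseteq> K s"
  unfolding rips_def by (auto intro: order_trans)

lemma pair_in_rips:
  assumes "x \<in> V" "y \<in> V"
  shows "{x, y} \<in> K r \<longleftrightarrow> dist x y \<le> r"
  using dist_refl[OF assms(1)] dist_refl[OF assms(2)] dist_sym[OF assms] assms unfolding rips_def by auto

lemma graph_subset_rips: "T \<subseteq> K 1"
proof
  fix s assume "s \<in> T"
  then have "(\<exists>v\<in>V. s = {v}) \<or> s \<in> E" unfolding graph_complex_def by auto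
  then show "s \<in> K 1"
  proof
    assume "\<exists>v\<in>V. s = {v}"
    then obtain v where "v \<in> V" "s = {v, v}" by auto
    then show ?thesis using pair_in_rips[of v v 1] dist_refl[of v] by simp
  next
    assume "s \<in> E"
    then obtain x y where "s = {x, y}" "x \<in> V" "y \<in> V" by (metis edge_obtain)
    then show ?thesis using pair_in_rips[of x y 1] dist_edge[of x y] \<open>s \<in> E\<close> by simp
  qed
qed

lemma dist_le_1:
  assumes "x \<in> V" "y \<in> V" "x \<noteq> y" "dist x y \<le> 1"
  shows "{x, y} \<in> E"
proof -
  have "dist x y \<noteq> 0" using dist_relpow[OF assms(1,2)] assms(3) by (intro notI) simp
  then have "dist x y = 1" using assms(4) by simp
  then show ?thesis using dist_relpow[OF assms(1,2)] unfolding adj_def by auto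
qed

text \<open>Distinct vertices at distance at most 1 are adjacent, so the two complexes have the same
  1-simplices.\<close>

lemma cycles_rips_1: "cycles (K 1) 1 = (cycles T 1 :: ('v list \<Rightarrow> 'a::normed_coeff_ring) set)"
proof
  show "cycles (K 1) 1 \<subseteq> (cycles T 1 :: ('v list \<Rightarrow> 'a) set)"
  proof
    fix c :: "'v list \<Rightarrow> 'a" assume c: "c \<in> cycles (K 1) 1"
    then have ch: "c \<in> chains (K 1) 1" and b: "bdry c = (\<lambda>ys. 0)" unfolding cycles_def by auto
    have "c \<in> chains T 1"
    proof (rule chains_1I)
      show "bounded_fun c" using ch unfolding chains_def by blast
      show "c [y, x] = - c [x, y]" for x y by (rule chains_1_antisym[OF ch])
      fix xs assume "c xs \<noteq> 0"
      then obtain x y where xy: "xs = [x, y]" "x \<noteq> y" "{x, y} \<in> K 1" using chains_1D[OF ch] by blast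
      then have "x \<in> V" "y \<in> V" "dist x y \<le> 1" unfolding rips_def by auto
      then have "{x, y} \<in> T" using dist_le_1 xy(2) edge_graph_complex by blast
      then show "\<exists>x y. xs = [x, y] \<and> x \<noteq> y \<and> {x, y} \<in> T" using xy by blast
    qed
    then show "c \<in> cycles T 1" using b unfolding cycles_def by blast
  qed
  show "cycles T 1 \<subseteq> (cycles (K 1) 1 :: ('v list \<Rightarrow> 'a) set)"
    by (rule cycles_mono[OF graph_subset_rips])
qed

section \<open>Shrinking the scale of a cycle\<close>

lemma shorten_cycle:
  fixes c :: "'v list \<Rightarrow> 'a::normed_coeff_ring"
  assumes r: "r \<ge> 1" and c: "c \<in> cycles (K (Suc r)) 1"
  shows "\<exists>c'\<in>cycles (K r) 1. (\<lambda>xs. c xs - c' xs) \<in> boundaries (K (Suc r)) 1"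
proof -
  have ch: "c \<in> chains (K (Suc r)) 1" using c unfolding cycles_def by blast
  obtain N where N: "N \<ge> 0" "\<And>xs. cnorm (c xs) \<le> N"
    using ch bounded_fun_pos unfolding chains_def by blast
  define far where "far x y \<longleftrightarrow> x \<in> V \<and> y \<in> V \<and> dist x y = Suc r" for x y
  \<comment> \<open>The vertex depends on the unordered pair, so both orientations of a long edge
    get the same triangle and \<open>g\<close> becomes antisymmetric in its outer arguments.\<close>
  define \<mu> where "\<mu> s = (SOME m. m \<in> V \<and> (\<forall>x\<in>s. dist x m \<le> r))" for s
  have far_sym: "far y x \<longleftrightarrow> far x y" for x y unfolding far_def using dist_sym by auto
  have \<mu>: "\<mu> {x, y} \<in> V \<and> dist x (\<mu> {x, y}) \<le> r \<and> dist y (\<mu> {x, y}) \<le> r" if "far x y" for x y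
  proof -
    have xy: "x \<in> V" "y \<in> V" "dist x y = Suc r" using that unfolding far_def by auto
    then obtain m where m: "m \<in> V" "dist x m \<le> r" "dist m y \<le> r" using dist_intermediate[OF _ _ _ r] by blast
    then have "\<exists>m. m \<in> V \<and> (\<forall>z\<in>{x, y}. dist z m \<le> r)" using dist_sym[of m y] xy by auto
    then show ?thesis unfolding \<mu>_def by (rule someI2_ex) auto
  qed
  \<comment> \<open>The triangle over the long edge from \<open>x\<close> to \<open>y\<close> with
    apex \<open>m\<close>, weighted by the coefficient of that edge.\<close>
  define g where "g x m y = (if far x y \<and> m = \<mu> {x, y} then c [x, y] else 0)" for x m y
  have g_swap: "g y m x = - g x m y" for x m y
    using chains_1_antisym[OF ch, of y x] far_sym[of x y] unfolding g_def by (simp add: insert_commute)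
  have g_nz: "far x y \<and> m \<in> V \<and> dist x m \<le> r \<and> dist y m \<le> r" if "g x m y \<noteq> 0" for x m y
    using that \<mu>[of x y] unfolding g_def by (auto split: if_splits)
  have g_simplex: "distinct [x, m, y] \<and> {x, m, y} \<in> K (Suc r)" if "g x m y \<noteq> 0" for x m y
  proof -
    have *: "x \<in> V" "y \<in> V" "m \<in> V" "dist x y = Suc r" "dist x m \<le> r" "dist y m \<le> r"
      using g_nz[OF that] unfolding far_def by auto
    then have "dist y x = Suc r" "dist m x \<le> r" "dist m y \<le> r" using dist_sym by auto
    then show ?thesis using * dist_refl unfolding rips_def by auto
  qed
  \<comment> \<open>Any of the three sides could be the long one; summing over the cyclic rotations
    makes the chain alternating.\<close>
  define d where "d xs = (case xs of [x, y, z] \<Rightarrow> g x y z + g y z x + g z x y | _ \<Rightarrow> 0)" for xs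
  have d3: "d [x, y, z] = g x y z + g y z x + g z x y" for x y z unfolding d_def by simp
  have d_len: "\<exists>x y z. xs = [x, y, z]" if "d xs \<noteq> 0" for xs
    using that unfolding d_def by (auto split: list.splits)
  have g_bound: "cnorm (g x m y) \<le> N" for x m y using N unfolding g_def by simp
  have d_chain: "d \<in> chains (K (Suc r)) (Suc 1)"
  proof -
    have "cnorm (d xs) \<le> 3 * N" for xs
    proof (cases "d xs = 0")
      case False
      then obtain x y z where "xs = [x, y, z]" using d_len by blast
      then have "cnorm (d xs) \<le> cnorm (g x y z) + cnorm (g y z x) + cnorm (g z x y)"
        unfolding d_def by (auto intro: order_trans[OF cnorm_add add_right_mono[OF cnorm_add]])
      then show ?thesis using g_bound[of x y z] g_bound[of y z x] g_bound[of z x y] by linarith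
    qed (use N in simp)
    then have "bounded_fun d" unfolding bounded_fun_def by blast
    moreover have "length xs = Suc (Suc 1) \<and> distinct xs \<and> set xs \<in> K (Suc r)" if nz: "d xs \<noteq> 0" for xs
    proof -
      obtain x y z where xs: "xs = [x, y, z]" using d_len[OF nz] by blast
      then have "g x y z \<noteq> 0 \<or> g y z x \<noteq> 0 \<or> g z x y \<noteq> 0" using nz d3 by auto
      moreover have "{y, z, x} = {x, y, z}" "{z, x, y} = {x, y, z}" by auto
      ultimately show ?thesis using g_simplex[of x y z] g_simplex[of y z x] g_simplex[of z x y] xs by auto
    qed
    moreover have "d (xs[i := xs ! j, j := xs ! i]) = - d xs" if ij: "i < j" "j < length xs" for xs i j
    proof (cases "\<exists>x y z. xs = [x, y, z]")
      case True
      then obtain x y z where xs: "xs = [x, y, z]" by blast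
      have "i = 0 \<and> j = 1 \<or> i = 0 \<and> j = 2 \<or> i = 1 \<and> j = 2" using ij xs by auto
      then show ?thesis
        using g_swap[of x y z] g_swap[of y z x] g_swap[of z x y] unfolding xs
        by (elim disjE) (simp_all add: d3)
    next
      case False
      have "d ys = 0" if "length ys \<noteq> 3" for ys
        using that by (rule contrapos_np) (auto dest: d_len)
      moreover have "length xs \<noteq> 3" using False by (auto simp: numeral_3_eq_3 length_Suc_conv)
      ultimately show ?thesis by simp
    qed
    ultimately show ?thesis unfolding chains_def by blast
  qed
  \<comment> \<open>With this sign the long edges cancel: on a long edge \<open>bdry d\<close> takes
    the value \<open>c [z, y] = - c [y, z]\<close>.\<close>
  define c' where "c' xs = c xs + bdry d xs" for xs
  have "bdry d \<in> boundaries (K (Suc r)) 1" using d_chain unfolding boundaries_def by blast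
  then have diff: "(\<lambda>xs. c xs - c' xs) \<in> boundaries (K (Suc r)) 1"
    using rips.boundaries_minus[of "bdry d" "Suc r" 1] unfolding c'_def by simp
  have "bdry d \<in> cycles (K (Suc r)) 1"
    using \<open>bdry d \<in> boundaries _ _\<close> rips.boundaries_subset_cycles by blast
  then have c'_cycle: "c' \<in> cycles (K (Suc r)) 1" unfolding c'_def by (rule rips.cycles_add[OF c])
  then have c'_chain: "c' \<in> chains (K (Suc r)) 1" unfolding cycles_def by blast
  have c'_far: "c' [y, z] = 0" if yz: "far y z" for y z
  proof -
    \<comment> \<open>The chosen vertex is inserted by hand, so that the sum of the delta function
      below can be evaluated.\<close>
    let ?X = "insert (\<mu> {z, y}) (rips.star (Suc r) y)"
    have fin: "finite ?X" using rips.finite_star by simp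
    have "bdry d [y, z] = (\<Sum>x\<in>?X. d [x, y, z])"
      by (rule bdry_eq_sum) (use rips.chain_support_star[OF d_chain] fin in auto)
    also have "\<dots> = (\<Sum>x\<in>?X. if x = \<mu> {z, y} then c [z, y] else 0)"
    proof (rule sum.cong[OF refl])
      fix x
      \<comment> \<open>The other two rotations would use the edge between \<open>y\<close> and
        \<open>z\<close> as a short side.\<close>
      have nd: "\<not> dist y z \<le> r" "\<not> dist z y \<le> r" using yz far_sym[of y z] unfolding far_def by auto
      then have "g x y z = 0" "g y z x = 0" using g_nz by blast+
      then show "d [x, y, z] = (if x = \<mu> {z, y} then c [z, y] else 0)"
        using yz far_sym[of y z] unfolding d3 g_def[of z x y] by simp
    qed
    also have "\<dots> = c [z, y]" using fin by simp
    also have "\<dots> = - c [y, z]" by (rule chains_1_antisym[OF ch])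
    finally show ?thesis unfolding c'_def by simp
  qed
  have "c' \<in> chains (K r) 1"
  proof (rule chains_1I)
    show "bounded_fun c'" using c'_chain unfolding chains_def by blast
    show "c' [y, x] = - c' [x, y]" for x y by (rule chains_1_antisym[OF c'_chain])
    fix xs assume nz: "c' xs \<noteq> 0"
    then obtain x y where xy: "xs = [x, y]" "x \<noteq> y" "{x, y} \<in> K (Suc r)"
      using chains_1D[OF c'_chain] by blast
    then have V: "x \<in> V" "y \<in> V" and "dist x y \<le> Suc r" unfolding rips_def by auto
    moreover have "dist x y \<noteq> Suc r" using nz xy V c'_far[of x y] unfolding far_def by auto
    ultimately have "{x, y} \<in> K r" using pair_in_rips[of x y r] by simp
    then show "\<exists>x y. xs = [x, y] \<and> x \<noteq> y \<and> {x, y} \<in> K r" using xy by blast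
  qed
  then have "c' \<in> cycles (K r) 1" using c'_cycle unfolding cycles_def by blast
  then show ?thesis using diff by blast
qed

text \<open>The descent stops at scale 1, where cycles are already flows; scales are written
  \<open>Suc r\<close> because shortening ends at a scale of at least 1. Boundaries at the smaller
  scales remain boundaries at the original one.\<close>

lemma cycle_homologous_to_flow:
  fixes c :: "'v list \<Rightarrow> 'a::normed_coeff_ring"
  assumes "c \<in> cycles (K (Suc r)) 1"
  shows "\<exists>c'\<in>cycles T 1. (\<lambda>xs. c xs - c' xs) \<in> boundaries (K (Suc r)) 1"
  using assms
proof (induction r arbitrary: c)
  case 0
  then have "c \<in> cycles (K 1) 1" by simp
  then have "c \<in> cycles T 1" unfolding cycles_rips_1 .
  then show ?case using rips.boundaries_zero[of 1] by (intro bexI[of _ c]) auto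
next
  case (Suc r)
  then obtain c1 where c1: "c1 \<in> cycles (K (Suc r)) 1"
    "(\<lambda>xs. c xs - c1 xs) \<in> boundaries (K (Suc (Suc r))) 1"
    using shorten_cycle[of "Suc r" c] by auto
  then obtain c2 where c2: "c2 \<in> cycles T 1" "(\<lambda>xs. c1 xs - c2 xs) \<in> boundaries (K (Suc r)) 1"
    using Suc.IH by blast
  have "boundaries (K (Suc r)) 1 \<subseteq> (boundaries (K (Suc (Suc r))) 1 :: ('v list \<Rightarrow> 'a) set)"
    by (intro boundaries_mono rips_mono) simp
  then have "(\<lambda>xs. (c xs - c1 xs) + (c1 xs - c2 xs)) \<in> boundaries (K (Suc (Suc r))) 1"
    using c1 c2 by (intro rips.boundaries_add) auto
  then show ?case using c2 by auto
qed

section \<open>The components of the tree after removal of an edge\<close>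

definition side :: "'v \<Rightarrow> 'v \<Rightarrow> 'v set" where
  "side a b = {x. (a, x) \<in> {(x, y). {x, y} \<in> E \<and> {x, y} \<noteq> {a, b}}\<^sup>*}"

text \<open>Acyclicity in \<open>tree\<close> speaks of walks without repetition. If the next vertex
  has been visited before, the walk is cut back to that visit.\<close>

lemma side_distinct_walk:
  assumes "x \<in> side a b" "a \<in> V"
  shows "\<exists>xs. walk V (E - {{a, b}}) xs \<and> distinct xs \<and> hd xs = a \<and> last xs = x"
proof -
  have "(a, x) \<in> {(x, y). {x, y} \<in> E \<and> {x, y} \<noteq> {a, b}}\<^sup>*" using assms unfolding side_def by simp
  then show ?thesis
  proof (induction rule: rtrancl_induct)
    case base
    show ?case using assms(2) by (intro exI[of _ "[a]"]) (simp add: walk_def)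
  next
    case (step x y)
    then obtain xs where xs: "walk V (E - {{a, b}}) xs" "distinct xs" "hd xs = a" "last xs = x" by blast
    have xy: "{x, y} \<in> E - {{a, b}}" "y \<in> V" using step edgeD[of x y] by auto
    show ?case
    proof (cases "y \<in> set xs")
      case True
      then obtain us vs where "xs = us @ y # vs" by (meson split_list)
      then have "xs = (us @ [y]) @ vs" by simp
      then have "walk V (E - {{a, b}}) (us @ [y])" "distinct (us @ [y])" "hd (us @ [y]) = a"
        using xs unfolding walk_def by (auto simp: successively_append_iff hd_append)
      then show ?thesis by (intro exI[of _ "us @ [y]"]) simp
    next
      case False
      then show ?thesis using xs xy unfolding walk_def
        by (intro exI[of _ "xs @ [y]"]) (auto simp: successively_append_iff hd_append)
    qed
  qed
qed

lemma side_props: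
  assumes "{a, b} \<in> E"
  shows "a \<in> side a b" "b \<notin> side a b"
    and "x \<in> side a b \<Longrightarrow> y \<notin> side a b \<Longrightarrow> {x, y} \<in> E \<Longrightarrow> x = a \<and> y = b"
proof -
  show a: "a \<in> side a b" unfolding side_def by simp
  \<comment> \<open>A walk without repetition from \<open>a\<close> to \<open>b\<close> that avoids
    the edge has at least three vertices, and the edge closes it up to a cycle.\<close>
  show b: "b \<notin> side a b"
  proof
    assume "b \<in> side a b"
    moreover have ab: "a \<noteq> b" "a \<in> V" using edgeD[OF assms] by auto
    ultimately obtain xs where xs: "walk V (E - {{a, b}}) xs" "distinct xs" "hd xs = a" "last xs = b"
      using side_distinct_walk by blast
    have "walk V E xs" using xs(1) unfolding walk_def by (auto intro: successively_mono)
    moreover have "length xs \<ge> 3"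
    proof (rule ccontr)
      assume "\<not> length xs \<ge> 3"
      then consider "xs = []" | z where "xs = [z]" | z w where "xs = [z, w]"
        by (cases xs rule: remdups_adj.cases) (auto simp: not_le less_Suc_eq_le)
      then show False using xs ab unfolding walk_def by cases auto
    qed
    moreover have "{last xs, hd xs} \<in> E" using xs assms by (simp add: insert_commute)
    ultimately show False using xs(2) trivalent unfolding trivalent_tree_def tree_def by blast
  qed
  assume x: "x \<in> side a b" and y: "y \<notin> side a b" and xy: "{x, y} \<in> E"
  have "{x, y} = {a, b}"
  proof (rule ccontr)
    assume "{x, y} \<noteq> {a, b}"
    then have "y \<in> side a b" using x xy unfolding side_def by (auto intro: rtrancl_into_rtrancl)
    then show False using y by simp
  qed
  then show "x = a \<and> y = b" using x y a b by (auto simp: doubleton_eq_iff)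
qed

text \<open>A side can be left only across the removed edge, hence through \<open>a\<close>. This
  keeps every simplex that meets both sides close to \<open>a\<close>.\<close>

lemma relpow_leaving_side:
  assumes "{a, b} \<in> E" "(x, y) \<in> adj ^^ n" "x \<in> side a b" "y \<notin> side a b"
  shows "\<exists>m\<le>n. (x, a) \<in> adj ^^ m"
  using assms(2,3)
proof (induction n arbitrary: x)
  case (Suc n)
  then obtain z where z: "(x, z) \<in> adj" "(z, y) \<in> adj ^^ n" by (meson relpow_Suc_D2)
  show ?case
  proof (cases "z \<in> side a b")
    case True
    then obtain m where "m \<le> n" "(z, a) \<in> adj ^^ m" using Suc.IH z by blast
    then show ?thesis using z(1) relpow_Suc_I2[of x z adj a m] by (intro exI[of _ "Suc m"]) auto
  next
    case False
    then have "x = a" using side_props(3)[OF assms(1)] Suc.prems z(1) unfolding adj_def by blast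
    then show ?thesis by (intro exI[of _ 0]) simp
  qed
qed (use assms(4) in simp)

lemma boundary_flow_zero:
  fixes c :: "'v list \<Rightarrow> 'a::normed_coeff_ring"
  assumes c: "c \<in> chains T 1" and bd: "c \<in> boundaries (K k) 1"
  shows "c = (\<lambda>xs. 0)"
proof -
  obtain d where d: "d \<in> chains (K k) (Suc 1)" and cd: "c = bdry d" using bd unfolding boundaries_def by blast
  have edge0: "c [a, b] = 0" if ab: "{a, b} \<in> E" for a b
  proof -
    have abV: "a \<in> V" "b \<in> V" "a \<noteq> b" using edgeD[OF ab] by auto
    let ?S = "side a b"
    \<comment> \<open>The sides may be infinite, so the sums are cut off. A triangle meeting both
      sides has a vertex within \<open>k\<close> of \<open>a\<close>, so all its vertices are within
      \<open>2 * k\<close>; the extra 1 keeps \<open>b\<close> inside when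
      \<open>k = 0\<close>.\<close>
    define D where "D = vball a (2 * k + 1)"
    define A where "A = D \<inter> ?S"
    define C where "C = D - ?S"
    have fin: "finite D" "finite A" "finite C" using vball_bounded unfolding D_def A_def C_def by auto
    have near: "z \<in> D" if x: "x \<in> ?S" and y: "y \<notin> ?S" and nz: "d [z, x, y] \<noteq> 0" for x y z
    proof -
      have "{z, x, y} \<in> K k" using chains_nonzeroD[OF d nz] by simp
      then have V: "x \<in> V" "y \<in> V" "z \<in> V" and le: "dist x y \<le> k" "dist x z \<le> k" unfolding rips_def by auto
      obtain m where m: "m \<le> dist x y" "(x, a) \<in> adj ^^ m"
        using relpow_leaving_side[OF ab dist_relpow[OF V(1,2)] x y] by blast
      then have "dist a x \<le> k" using dist_le[OF abV(1) adj_relpow_sym] le by fastforce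
      then have "dist a z \<le> 2 * k + 1" using dist_triangle[OF abV(1) V(1,3)] le by linarith
      then show ?thesis using vball_iff abV V unfolding D_def by blast
    qed
    have "a \<in> D" unfolding D_def vball_def by (intro CollectI exI[of _ 0]) simp
    moreover have "b \<in> D"
      using ab unfolding D_def vball_def adj_def by (intro CollectI exI[of _ 1]) simp
    ultimately have "a \<in> A" "b \<in> C" using side_props(1,2)[OF ab] unfolding A_def C_def by auto
    have sum_A: "(\<Sum>x\<in>A. \<Sum>z\<in>A. d [z, x, y]) = 0" for y
    proof (rule sum_antisymmetric_eq_0[OF fin(2)])
      show "d [z, x, y] = - d [x, z, y]" for x z by (rule chains_swap_hd[OF d])
      show "d [x, x, y] = 0" for x using chains_nonzeroD[OF d, of "[x, x, y]"] by auto
    qed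
    have sum_C: "(\<Sum>y\<in>C. \<Sum>z\<in>C. d [z, x, y]) = 0" for x
    proof (rule sum_antisymmetric_eq_0[OF fin(3)])
      show "d [z, x, y] = - d [y, x, z]" for y z using chains_swap[OF d, of 0 2 "[y, x, z]"] by simp
      show "d [y, x, y] = 0" for y using chains_nonzeroD[OF d, of "[y, x, y]"] by auto
    qed
    \<comment> \<open>Among all pairs across the cut only \<open>(a, b)\<close> is an edge, so the
      double sum is the value of the flow there.\<close>
    have "(\<Sum>x\<in>A. \<Sum>y\<in>C. c [x, y]) = (\<Sum>x\<in>A. \<Sum>y\<in>C. if y = b then if x = a then c [a, b] else 0 else 0)"
    proof (intro sum.cong refl)
      fix x y assume "x \<in> A" "y \<in> C"
      then have S: "x \<in> ?S" "y \<notin> ?S" unfolding A_def C_def by auto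
      show "c [x, y] = (if y = b then if x = a then c [a, b] else 0 else 0)"
      proof (cases "c [x, y] = 0")
        case False
        then show ?thesis using side_props(3)[OF ab S graph_chain_edge[OF c False]] by simp
      qed auto
    qed
    also have "\<dots> = c [a, b]" using fin \<open>a \<in> A\<close> \<open>b \<in> C\<close> by simp
    finally have "c [a, b] = (\<Sum>x\<in>A. \<Sum>y\<in>C. c [x, y])" by simp
    \<comment> \<open>The third vertex \<open>z\<close> lies on one of the two sides, together with
      \<open>x\<close> or together with \<open>y\<close>. Each kind cancels by antisymmetry in the
      two vertices on the same side.\<close>
    also have "\<dots> = (\<Sum>x\<in>A. \<Sum>y\<in>C. (\<Sum>z\<in>A. d [z, x, y]) + (\<Sum>z\<in>C. d [z, x, y]))"
    proof (intro sum.cong refl)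
      fix x y assume xy: "x \<in> A" "y \<in> C"
      have "bdry d [x, y] = (\<Sum>z\<in>A \<union> C. d [z, x, y])"
        by (rule bdry_eq_sum) (use near xy fin in \<open>auto simp: A_def C_def\<close>)
      also have "\<dots> = (\<Sum>z\<in>A. d [z, x, y]) + (\<Sum>z\<in>C. d [z, x, y])"
        by (rule sum.union_disjoint) (use fin in \<open>auto simp: A_def C_def\<close>)
      finally show "c [x, y] = (\<Sum>z\<in>A. d [z, x, y]) + (\<Sum>z\<in>C. d [z, x, y])" using cd by simp
    qed
    also have "\<dots> = (\<Sum>y\<in>C. \<Sum>x\<in>A. \<Sum>z\<in>A. d [z, x, y]) + (\<Sum>x\<in>A. \<Sum>y\<in>C. \<Sum>z\<in>C. d [z, x, y])"
      unfolding sum.distrib by (subst sum.swap) simp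
    also have "\<dots> = 0" unfolding sum_A sum_C by simp
    finally show ?thesis .
  qed
  show ?thesis
  proof
    fix xs show "c xs = 0"
    proof (rule ccontr)
      assume nz: "c xs \<noteq> 0"
      then obtain x y where "xs = [x, y]" using chains_1D[OF c] by blast
      then show False using nz edge0 graph_chain_edge[OF c] by blast
    qed
  qed
qed

section \<open>Comparison with uniformly finite homology\<close>

lemma suf_to_uf_iso:
  "(suf_to_uf V E 1 :: ('v list \<Rightarrow> 'a::normed_coeff_ring) set \<Rightarrow> _) \<in> iso (H_suf T 1) (H_uf V E 1)"
proof -
  let ?G = "\<lambda>r. H_suf (K r) 1 :: ('v list \<Rightarrow> 'a) set monoid"
  let ?\<phi> = "\<lambda>(r :: nat) s. incl_map (K s) 1 :: ('v list \<Rightarrow> 'a) set \<Rightarrow> _"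
  have incl: "incl_map (K s) 1 (hclass (K r) 1 z) = hclass (K s) 1 z" if "r \<le> s" for r s and z :: "'v list \<Rightarrow> 'a"
    by (rule incl_map_hclass[OF bounded_complex_rips bounded_complex_rips rips_mono[OF that]])
  have incl_T: "incl_map (K 1) 1 (hclass T 1 z) = hclass (K 1) 1 z" for z :: "'v list \<Rightarrow> 'a"
    by (rule incl_map_hclass[OF bounded_complex_graph bounded_complex_rips graph_subset_rips])
  interpret direct_system ?G ?\<phi>
  proof
    fix m and a b :: "('v list \<Rightarrow> 'a) set" assume "a \<in> carrier (?G m)" "b \<in> carrier (?G m)"
    then show "a \<otimes>\<^bsub>?G m\<^esub> b \<in> carrier (?G m)"
      unfolding rips.carrier_H_suf using rips.H_suf_mult rips.cycles_add by fastforce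
  next
    fix m n :: nat assume "m \<le> n"
    then show "?\<phi> m n \<in> hom (?G m) (?G n)"
      by (intro incl_map_hom bounded_complex_rips rips_mono)
  next
    fix k m n :: nat and a :: "('v list \<Rightarrow> 'a) set"
    assume "k \<le> m" "m \<le> n" "a \<in> carrier (?G k)"
    then show "?\<phi> m n (?\<phi> k m a) = ?\<phi> k n a"
      unfolding rips.carrier_H_suf by (auto simp: incl simp del: One_nat_def)
  qed
  have "(\<lambda>X. rel `` {(1, incl_map (K 1) 1 X)}) \<in> iso (H_suf T 1) (dirlim ?G ?\<phi>)"
  proof (rule iso_dirlim)
    show "incl_map (K 1) 1 \<in> hom (H_suf T 1) (?G 1)"
      by (intro incl_map_hom bounded_complex_graph bounded_complex_rips graph_subset_rips)
  next
    fix X Y :: "('v list \<Rightarrow> 'a) set" and k :: nat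
    assume XY: "X \<in> carrier (H_suf T 1)" "Y \<in> carrier (H_suf T 1)" and k: "1 \<le> k"
      and eq: "incl_map (K k) 1 (incl_map (K 1) 1 X) = incl_map (K k) 1 (incl_map (K 1) 1 Y)"
    obtain x y where x: "x \<in> cycles T 1" "X = hclass T 1 x" and y: "y \<in> cycles T 1" "Y = hclass T 1 y"
      using XY unfolding graph.carrier_H_suf by blast
    have "(\<lambda>xs. x xs - y xs) \<in> boundaries (K k) 1"
      using eq unfolding x(2) y(2) incl_T incl[OF k] rips.hclass_eq_iff .
    moreover have "(\<lambda>xs. x xs - y xs) \<in> chains T 1"
      using graph.cycles_diff[OF x(1) y(1)] unfolding cycles_def by blast
    ultimately have "(\<lambda>xs. x xs - y xs) = (\<lambda>xs. 0)" using boundary_flow_zero by blast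
    then have "x = y" by (simp add: fun_eq_iff)
    then show "X = Y" using x y by simp
  next
    fix m and X :: "('v list \<Rightarrow> 'a) set" assume "X \<in> carrier (?G m)"
    then obtain z where z: "z \<in> cycles (K m) 1" "X = hclass (K m) 1 z" unfolding rips.carrier_H_suf by blast
    \<comment> \<open>Moving up to scale \<open>Suc m\<close> covers \<open>m = 0\<close>, since the
      descent starts from a scale of at least 1.\<close>
    have "z \<in> cycles (K (Suc m)) 1" using z(1) cycles_mono[OF rips_mono, of m "Suc m"] by auto
    then obtain c where c: "c \<in> cycles T 1" "(\<lambda>xs. z xs - c xs) \<in> boundaries (K (Suc m)) 1"
      using cycle_homologous_to_flow by blast
    have "incl_map (K (Suc m)) 1 (incl_map (K 1) 1 (hclass T 1 c)) = incl_map (K (Suc m)) 1 X"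
      using rips.hclass_eq_iff[of "Suc m" 1 z c] c(2) unfolding z(2) incl_T
      by (simp add: incl del: One_nat_def)
    moreover have "hclass T 1 c \<in> carrier (H_suf T 1)" using c(1) unfolding graph.carrier_H_suf by blast
    ultimately show "\<exists>x\<in>carrier (H_suf T 1). \<exists>k. 1 \<le> k \<and> m \<le> k \<and>
        incl_map (K k) 1 (incl_map (K 1) 1 x) = incl_map (K k) 1 X"
      by (intro bexI[of _ "hclass T 1 c"] exI[of _ "Suc m"]) auto
  qed
  then show ?thesis unfolding H_uf_def suf_to_uf_def .
qed

end

section \<open>Coordinates along the rays\<close>

locale ray_tree =
  fixes V :: "'v set" and E :: "'v set set" and mid :: bool
    and L :: "int \<Rightarrow> 'v" and B :: "nat \<Rightarrow> 'v set" and R :: "'v \<Rightarrow> nat \<Rightarrow> 'v"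
  assumes construction: "ray_construction V E mid L B R"
begin

section \<open>Stages, and positions on rays as coordinates of vertices\<close>

abbreviation stage :: "nat \<Rightarrow> 'v set" where
  "stage \<equiv> stage_verts mid L B R"

definition branch_points :: "'v set" where
  "branch_points = (\<Union>n\<in>{1..}. B n)"

definition all_rays :: "(nat \<Rightarrow> 'v) set" where
  "all_rays = (\<Union>n. rays mid L B R n)"

abbreviation pos_ray :: "nat \<Rightarrow> 'v" where
  "pos_ray \<equiv> \<lambda>i. L (int i)"

abbreviation neg_ray :: "nat \<Rightarrow> 'v" where
  "neg_ray \<equiv> \<lambda>i. L (of_bool mid - int i)"

lemma L_eq_iff [simp]: "L i = L j \<longleftrightarrow> i = j"
  using construction by (auto simp: ray_construction_def inj_eq)

lemma B_subset: "n \<ge> 1 \<Longrightarrow> B n \<subseteq> stage n - stage (n - 1)"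
  using construction unfolding ray_construction_def by blast

lemma R_props:
  assumes "n \<ge> 1" "v \<in> B n"
  shows "R v 0 = v" "inj (R v)" "R v (Suc i) \<notin> stage n"
  using construction assms unfolding ray_construction_def by blast+

lemma R_disjoint:
  assumes "n \<ge> 1" "v \<in> B n" "w \<in> B n" "R v i = R w j"
  shows "v = w"
proof -
  have "range (R v) \<inter> range (R w) = {}" if "v \<noteq> w"
    using construction assms that unfolding ray_construction_def by blast
  with assms(4) show ?thesis by blast
qed

lemma V_eq: "V = (\<Union>n. stage n)" and E_eq_stages: "E = (\<Union>n. stage_edges L B R n)"
  using construction unfolding ray_construction_def by blast+

lemma stage_mono: "m \<le> n \<Longrightarrow> stage m \<subseteq> stage n"
proof (rule lift_Suc_mono_le[of stage])
  fix k show "stage k \<subseteq> stage (Suc k)" by (cases k) auto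
qed

text \<open>The stage records the age of a vertex. Position 0 is left out: it is the point of gluing
  and belongs to an older stage, apart from the line rays around a suppressed root.\<close>

lemma rays_new_vertex:
  assumes "r \<in> rays mid L B R n" "k \<ge> 1"
  shows "r k \<in> stage n - stage (n - 1)"
proof (cases n)
  case (Suc m)
  show ?thesis
  proof (cases m)
    case 0
    with Suc assms show ?thesis by auto
  next
    case (Suc l)
    with \<open>n = Suc m\<close> assms obtain v where v: "v \<in> B (Suc l)" "r = R v" by auto
    obtain i where i: "k = Suc i" using assms(2) by (cases k) auto
    from R_props(3)[of "Suc l" v i] v i Suc \<open>n = Suc m\<close> show ?thesis by auto
  qed
qed (use assms in auto)

lemma level_unique:
  assumes "x \<in> stage m - stage (m - 1)" "x \<in> stage n - stage (n - 1)"
  shows "m = n"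
proof (rule ccontr)
  assume "m \<noteq> n"
  then consider "m \<le> n - 1" | "n \<le> m - 1" by linarith
  then show False using stage_mono assms by cases blast+
qed

lemma rays_inj: "r \<in> rays mid L B R n \<Longrightarrow> inj r"
proof (cases "(mid, L, B, R, n)" rule: rays.cases)
  case (3 a b c d m)
  assume "r \<in> rays mid L B R n"
  with 3 show ?thesis using R_props(2)[of "Suc m"] by auto
qed (auto simp: inj_on_def)

lemma ray_inj: "r \<in> all_rays \<Longrightarrow> r i = r j \<longleftrightarrow> i = j"
  unfolding all_rays_def using rays_inj by (auto simp: inj_eq)

text \<open>A common vertex fixes the stage at which both rays were created. Rays glued at one stage
  are disjoint, and the two line rays are disjoint from position 1 on, whether or not the root is
  suppressed.\<close>

lemma ray_coords_unique:
  assumes "r \<in> all_rays" "s \<in> all_rays" "k \<ge> 1" "l \<ge> 1" "r k = s l"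
  shows "r = s \<and> k = l"
proof -
  obtain m n where mn: "r \<in> rays mid L B R m" "s \<in> rays mid L B R n"
    using assms unfolding all_rays_def by blast
  then have [simp]: "m = n" using rays_new_vertex assms level_unique by metis
  have "r = s"
    using mn assms by (cases "(mid, L, B, R, n)" rule: rays.cases) (auto dest: R_disjoint[rotated])
  then show ?thesis using assms ray_inj by blast
qed

lemma R_in_all_rays: "v \<in> branch_points \<Longrightarrow> R v \<in> all_rays"
proof -
  assume "v \<in> branch_points"
  then obtain n where "n \<ge> 1" "v \<in> B n" unfolding branch_points_def by auto
  then have "R v \<in> rays mid L B R (Suc n)" by (cases n) auto
  then show ?thesis unfolding all_rays_def by blast
qed

lemma R_0: "v \<in> branch_points \<Longrightarrow> R v 0 = v"
  unfolding branch_points_def using R_props(1) by auto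

lemma line_rays: "pos_ray \<in> all_rays" "neg_ray \<in> all_rays"
  unfolding all_rays_def by (auto intro!: exI[of _ "Suc 0"])

lemma all_rays_cases:
  assumes "r \<in> all_rays"
  obtains "r = pos_ray" | "r = neg_ray" | v where "v \<in> branch_points" "r = R v"
proof -
  obtain n where "r \<in> rays mid L B R n" using assms unfolding all_rays_def by blast
  then show ?thesis using that
    by (cases "(mid, L, B, R, n)" rule: rays.cases) (auto simp: branch_points_def)
qed

lemma stage_new_vertex:
  assumes "x \<in> stage n - stage (n - 1)"
  obtains r k where "r \<in> rays mid L B R n" "k \<ge> 1" "x = r k"
proof (cases "(mid, L, B, R, n)" rule: rays.cases)
  case (2 a b c d)
  then have [simp]: "n = Suc 0" by simp
  obtain j where j: "x = L j" using assms by auto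
  show ?thesis
  proof (cases "j \<ge> 1")
    case True
    then show ?thesis using j by (intro that[of pos_ray "nat j"]) auto
  next
    case False
    \<comment> \<open>The case of the root itself is excluded: unless it is suppressed,
      \<open>L 0\<close> already belongs to stage 0.\<close>
    then have "j < of_bool mid" using assms j by (cases mid; cases "j = 0") auto
    then show ?thesis using j by (intro that[of neg_ray "nat (of_bool mid - j)"]) auto
  qed
next
  case (3 a b c d m)
  then have n: "n = Suc (Suc m)" by simp
  then obtain v i where v: "v \<in> B (Suc m)" "x = R v i" using assms by auto
  have "i \<noteq> 0"
  proof
    assume "i = 0"
    then have "x \<in> stage (Suc m)" using v R_props(1)[of "Suc m" v] B_subset[of "Suc m"] by auto
    then show False using assms n by simp
  qed
  then show ?thesis using v n by (intro that[of "R v" i]) auto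
qed (use assms in auto)

lemma vertex_cases:
  assumes "x \<in> V"
  obtains r k where "r \<in> all_rays" "k \<ge> 1" "x = r k" | "\<not> mid" "x = L 0"
proof -
  define n where "n = (LEAST n. x \<in> stage n)"
  have n: "x \<in> stage n" using assms unfolding V_eq n_def by (auto intro: LeastI)
  show ?thesis
  proof (cases n)
    case 0
    then show ?thesis using n that(2) by (auto split: if_splits)
  next
    case (Suc m)
    then have "x \<notin> stage (n - 1)" unfolding n_def
      by (metis diff_less less_Suc_eq_0_disj not_less_Least zero_less_one)
    with n obtain r k where "r \<in> rays mid L B R n" "k \<ge> 1" "x = r k"
      using stage_new_vertex[of x n] by blast
    then show ?thesis using that(1)[of r k] unfolding all_rays_def by blast
  qed
qed

lemma rays_in_stage: "r \<in> rays mid L B R n \<Longrightarrow> r k \<in> stage n"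
  by (cases "(mid, L, B, R, n)" rule: rays.cases) auto

lemma branch_point_coords:
  assumes "v \<in> branch_points"
  obtains r k where "r \<in> all_rays" "k \<ge> 1" "v = r k"
proof -
  obtain n where "n \<ge> 1" "v \<in> B n" using assms unfolding branch_points_def by auto
  then obtain r k where "r \<in> rays mid L B R n" "k \<ge> 1" "v = r k"
    using B_subset stage_new_vertex[of v n] by blast
  then show ?thesis using that[of r k] unfolding all_rays_def by blast
qed

text \<open>The exception is a suppressed root: the origins \<open>L 0\<close> and
  \<open>L 1\<close> of the line rays then appear only at stage 1.\<close>

lemma ray_origin_not_new:
  assumes "r \<in> rays mid L B R n" "\<not> (mid \<and> n = 1)"
  shows "r 0 \<in> stage (n - 1)"
proof (cases "(mid, L, B, R, n)" rule: rays.cases)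
  case (3 a b c d m)
  then show ?thesis using assms R_props(1)[of "Suc m"] B_subset[of "Suc m"] by auto
qed (use assms in auto)

text \<open>If the root is suppressed, both rays of the line start by crossing \<open>{L 0, L 1}\<close>.\<close>

lemma opposite_edges:
  assumes "r \<in> all_rays" "s \<in> all_rays" "r k = s (Suc l)" "r (Suc k) = s l"
  shows "mid \<and> k = 0 \<and> l = 0 \<and> (r = pos_ray \<and> s = neg_ray \<or> r = neg_ray \<and> s = pos_ray)"
proof -
  have "l = 0"
  proof (rule ccontr)
    assume "l \<noteq> 0"
    then have "r = s" "l = Suc k" using ray_coords_unique[of r s "Suc k" l] assms by auto
    then show False using assms ray_inj by auto
  qed
  have "k = 0"
  proof (rule ccontr)
    assume "k \<noteq> 0"
    then have "r = s" "k = Suc l" using ray_coords_unique[of r s k "Suc l"] assms by auto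
    then show False using assms ray_inj by auto
  qed
  obtain m n where mn: "r \<in> rays mid L B R m" "s \<in> rays mid L B R n"
    using assms unfolding all_rays_def by blast
  have r1: "r 1 \<in> stage m - stage (m - 1)" and s1: "s 1 \<in> stage n - stage (n - 1)"
    using mn rays_new_vertex by auto
  have eq: "r 0 = s 1" "r 1 = s 0" using assms \<open>k = 0\<close> \<open>l = 0\<close> by auto
  \<comment> \<open>Any other ray starts at a vertex older than its position 1; then
    \<open>r 0 = s 1\<close> and \<open>s 0 = r 1\<close> cannot both hold.\<close>
  have "mid \<and> m = 1 \<and> n = 1"
  proof (rule ccontr)
    assume neg: "\<not> ?thesis"
    have pos: "m \<noteq> 0" "n \<noteq> 0" using mn by (auto intro!: Nat.gr0I)
    show False
    proof (cases "mid \<and> m = 1")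
      case True
      then have "s 0 \<in> stage (n - 1)" using neg mn ray_origin_not_new by auto
      moreover have "stage m \<subseteq> stage (n - 1)" using True neg pos by (intro stage_mono) auto
      moreover have "r 0 \<in> stage m" using True mn by auto
      ultimately show False using s1 eq by auto
    next
      case False
      then have "s 1 \<in> stage (m - 1)" using mn ray_origin_not_new[of r m] eq by simp
      then have "\<not> m - 1 \<le> n - 1" using s1 stage_mono[of "m - 1" "n - 1"] by blast
      then have "n \<le> m - 1" by linarith
      moreover have "s 0 \<in> stage n" using mn(2) rays_in_stage by blast
      ultimately show False using r1 eq stage_mono[of n "m - 1"] by auto
    qed
  qed
  then show ?thesis using mn eq \<open>k = 0\<close> \<open>l = 0\<close> by auto
qed

lemma E_eq: "E = {{r k, r (Suc k)} | r k. r \<in> all_rays}"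
proof (intro equalityI subsetI)
  fix e assume "e \<in> E"
  then obtain n where "e \<in> stage_edges L B R n" unfolding E_eq_stages by blast
  then show "e \<in> {{r k, r (Suc k)} | r k. r \<in> all_rays}"
  proof (induction n rule: induct_nat_012)
    case 1
    then obtain j where j: "e = {L j, L (j + 1)}" by auto
    show ?case
    proof (cases "j \<ge> 0")
      case True
      then have "e = {pos_ray (nat j), pos_ray (Suc (nat j))}" using j by (simp add: add.commute)
      then show ?thesis by (intro CollectI exI[of _ pos_ray] exI[of _ "nat j"] conjI line_rays)
    next
      case False
      \<comment> \<open>\<open>neg_ray\<close> runs backwards: \<open>L (j + 1)\<close> comes first,
        at position \<open>of_bool mid - j - 1\<close>, which is nonnegative as
        \<open>j < 0\<close>.\<close>
      then have "e = {neg_ray (nat (of_bool mid - j - 1)), neg_ray (Suc (nat (of_bool mid - j - 1)))}"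
        using j by (auto simp: algebra_simps)
      then show ?thesis
        by (intro CollectI exI[of _ neg_ray] exI[of _ "nat (of_bool mid - j - 1)"] conjI line_rays)
    qed
  next
    case (ge2 n)
    then show ?case
    proof (cases "e \<in> stage_edges L B R (Suc n)")
      case False
      then obtain v i where "v \<in> B (Suc n)" "e = {R v i, R v (Suc i)}" using ge2 by auto
      then show ?thesis using R_in_all_rays[of v] unfolding branch_points_def by auto
    qed auto
  qed auto
next
  fix e assume "e \<in> {{r k, r (Suc k)} | r k. r \<in> all_rays}"
  then obtain r k where r: "r \<in> all_rays" "e = {r k, r (Suc k)}" by blast
  then show "e \<in> E"
  proof (cases rule: all_rays_cases)
    case 1
    then have "e \<in> stage_edges L B R (Suc 0)" using r by (auto simp: add.commute)
    then show ?thesis unfolding E_eq_stages by blast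
  next
    case 2
    then have "e = {L (of_bool mid - int k - 1), L (of_bool mid - int k - 1 + 1)}"
      using r by (auto simp: algebra_simps)
    then have "e \<in> stage_edges L B R (Suc 0)" unfolding stage_edges.simps by (rule range_eqI)
    then show ?thesis unfolding E_eq_stages by blast
  next
    case (3 v)
    then obtain n where n: "n \<ge> 1" "v \<in> B n" unfolding branch_points_def by auto
    then have "e \<in> stage_edges L B R (Suc n)" using 3 r by (cases n) auto
    then show ?thesis unfolding E_eq_stages by blast
  qed
qed

lemma ray_edge: "r \<in> all_rays \<Longrightarrow> {r k, r (Suc k)} \<in> E"
  unfolding E_eq by blast

lemma root_not_new:
  assumes "r \<in> all_rays" "\<not> mid"
  shows "r (Suc k) \<noteq> L 0"
proof -
  obtain n where n: "r \<in> rays mid L B R n" using assms unfolding all_rays_def by blast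
  have "L 0 \<in> stage (n - 1)" using stage_mono[of 0 "n - 1"] assms(2) by auto
  then show ?thesis using rays_new_vertex[OF n, of "Suc k"] by auto
qed

lemma neighbours_on_ray:
  assumes "r \<in> all_rays"
  shows "{x. {x, r (Suc k)} \<in> E} =
    {r k, r (Suc (Suc k))} \<union> (if r (Suc k) \<in> branch_points then {R (r (Suc k)) 1} else {})"
    (is "?N = ?M")
proof (intro equalityI subsetI)
  fix x assume "x \<in> ?N"
  then obtain s l where s: "s \<in> all_rays" "{x, r (Suc k)} = {s l, s (Suc l)}" unfolding E_eq by auto
  then consider "x = s l" "r (Suc k) = s (Suc l)" | "x = s (Suc l)" "r (Suc k) = s l"
    by (auto simp: doubleton_eq_iff)
  then show "x \<in> ?M"
  proof cases
    case 1
    then show ?thesis using ray_coords_unique[of r s "Suc k" "Suc l"] assms s by auto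
  next
    case 2
    show ?thesis
    proof (cases "l = 0")
      case False
      then show ?thesis using ray_coords_unique[of r s "Suc k" l] assms s 2 by auto
    next
      case True
      \<comment> \<open>A ray starting at this vertex is either glued here or, around a suppressed
        root, the opposite line ray; in the latter case its first edge is \<open>{r 0, r 1}\<close>
        once more.\<close>
      show ?thesis using s(1)
      proof (cases rule: all_rays_cases)
        case 1
        then have "mid" using 2 True root_not_new[OF assms] by auto
        then have "r (Suc k) = neg_ray 1" using 1 2 True by simp
        then have "r = neg_ray \<and> Suc k = 1"
          using ray_coords_unique[OF assms line_rays(2), of "Suc k" 1] by auto
        then show ?thesis using \<open>mid\<close> 1 2 True by auto
      next
        case neg: 2
        then have "mid" using 2 True root_not_new[OF assms] by (cases mid) auto
        then have "r (Suc k) = pos_ray 1" using neg 2 True by simp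
        then have "r = pos_ray \<and> Suc k = 1"
          using ray_coords_unique[OF assms line_rays(1), of "Suc k" 1] by auto
        then show ?thesis using \<open>mid\<close> neg 2 True by auto
      next
        case (3 v)
        then show ?thesis using True 2 R_0 by auto
      qed
    qed
  qed
next
  fix x assume "x \<in> ?M"
  then show "x \<in> ?N" using ray_edge[OF assms, of k] ray_edge[OF assms, of "Suc k"]
     ray_edge[OF R_in_all_rays, of "r (Suc k)" 0] R_0
    by (auto simp: insert_commute split: if_splits)
qed

end

section \<open>The bi-infinite paths\<close>

text \<open>Directed edges: both the sign in \<open>bip_chain\<close> and membership in
  \<open>bip_edges\<close> are read off from them.\<close>

definition arcs :: "(int \<Rightarrow> 'v) \<Rightarrow> ('v \<times> 'v) set" where
  "arcs p = range (\<lambda>k. (p k, p (k + 1)))"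

lemma bip_chain_arcs:
  "bip_chain p [x, y] = (if (x, y) \<in> arcs p then 1 else if (y, x) \<in> arcs p then - 1 else 0)"
  unfolding bip_chain_def arcs_def by auto

lemma bip_edges_arcs: "{x, y} \<in> bip_edges p \<longleftrightarrow> (x, y) \<in> arcs p \<or> (y, x) \<in> arcs p"
  unfolding bip_edges_def arcs_def by (auto simp: doubleton_eq_iff)

text \<open>Split at time 0, where the formulas of \<open>join_bip\<close> and
  \<open>end_bip\<close> change.\<close>

lemma arcs_iff: "(x, y) \<in> arcs p \<longleftrightarrow> (\<exists>k\<ge>0. x = p (- k - 1) \<and> y = p (- k)) \<or> (\<exists>k\<ge>0. x = p k \<and> y = p (k + 1))"
proof
  assume "(x, y) \<in> arcs p"
  then obtain k where k: "x = p k" "y = p (k + 1)" unfolding arcs_def by auto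
  show "(\<exists>k\<ge>0. x = p (- k - 1) \<and> y = p (- k)) \<or> (\<exists>k\<ge>0. x = p k \<and> y = p (k + 1))"
  proof (cases "k \<ge> 0")
    case False
    then show ?thesis using k by (intro disjI1 exI[of _ "- k - 1"]) (auto simp: add.commute)
  qed (use k in blast)
next
  have "(p (- k - 1), p (- k)) \<in> arcs p" for k
    unfolding arcs_def by (rule range_eqI[of _ _ "- k - 1"]) simp
  then show "(\<exists>k\<ge>0. x = p (- k - 1) \<and> y = p (- k)) \<or> (\<exists>k\<ge>0. x = p k \<and> y = p (k + 1))
      \<Longrightarrow> (x, y) \<in> arcs p"
    unfolding arcs_def by auto
qed

context ray_tree
begin

section \<open>Branching points along a ray, in order, and the bips they name\<close>

abbreviation bpos :: "(nat \<Rightarrow> 'v) \<Rightarrow> nat set" where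
  "bpos \<equiv> branch_pos branch_points"

abbreviation P :: "(int \<Rightarrow> 'v) set" where
  "P \<equiv> bips mid L B R"

text \<open>The value at \<open>k\<close> belongs to the edge from \<open>r k\<close> to
  \<open>r (Suc k)\<close>, so a branching point at \<open>k\<close> itself counts. Position 0 never
  does: that vertex branches, if at all, as a point of another ray.\<close>

primrec last_branch :: "(nat \<Rightarrow> 'v) \<Rightarrow> nat \<Rightarrow> nat option" where
  "last_branch r 0 = None"
| "last_branch r (Suc k) = (if r (Suc k) \<in> branch_points then Some (Suc k) else last_branch r k)"

lemma last_branch_Some_iff:
  "last_branch r k = Some i \<longleftrightarrow> i \<in> bpos r \<and> i \<le> k \<and> (\<forall>m\<in>bpos r. \<not> (i < m \<and> m \<le> k))"
proof (induction k)
  case (Suc k)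
  then show ?case by (auto simp: branch_pos_def le_Suc_eq)
qed (auto simp: branch_pos_def)

text \<open>A relation and not a function, as a ray may carry no further branching point.\<close>

definition next_branch :: "(nat \<Rightarrow> 'v) \<Rightarrow> nat \<Rightarrow> nat \<Rightarrow> bool" where
  "next_branch r i j \<longleftrightarrow> j \<in> bpos r \<and> i < j \<and> (\<forall>m\<in>bpos r. \<not> (i < m \<and> m < j))"

lemma next_branch_iff:
  assumes "i \<in> bpos r"
  shows "next_branch r i (Suc j) \<longleftrightarrow> r (Suc j) \<in> branch_points \<and> last_branch r j = Some i"
  using assms unfolding next_branch_def last_branch_Some_iff
  by (auto simp: branch_pos_def less_Suc_eq_le)

lemma next_branch_unique: "next_branch r i j \<Longrightarrow> next_branch r i k \<Longrightarrow> j = k"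
  unfolding next_branch_def by (meson linorder_neqE_nat)

lemma next_branch_cases:
  obtains j where "next_branch r i j" | "\<forall>j\<in>bpos r. j \<le> i"
proof (cases "\<exists>j. j \<in> bpos r \<and> i < j")
  case True
  define j where "j = (LEAST j. j \<in> bpos r \<and> i < j)"
  have "j \<in> bpos r \<and> i < j" unfolding j_def using True by (rule LeastI_ex)
  moreover have "\<not> (i < m \<and> m < j)" if "m \<in> bpos r" for m
    using not_less_Least[of m "\<lambda>j. j \<in> bpos r \<and> i < j"] that unfolding j_def by blast
  ultimately show ?thesis using that(1) unfolding next_branch_def by blast
qed (use that(2) linorder_not_less in blast)

text \<open>Names each bip other than \<open>L\<close> by the branching point where it comes in. The
  two families of the construction become one, indexed by the branching points on
  \<open>r\<close>.\<close>

definition bip_at :: "(nat \<Rightarrow> 'v) \<Rightarrow> nat \<Rightarrow> int \<Rightarrow> 'v" where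
  "bip_at r i =
     (if \<exists>j. next_branch r i j then join_bip R r i (THE j. next_branch r i j) else end_bip R r i)"

lemma bip_at_join: "next_branch r i j \<Longrightarrow> bip_at r i = join_bip R r i j"
proof -
  assume j: "next_branch r i j"
  then have "(THE j. next_branch r i j) = j" using next_branch_unique by blast
  with j show ?thesis unfolding bip_at_def by auto
qed

lemma bip_at_end: "\<forall>j\<in>bpos r. j \<le> i \<Longrightarrow> bip_at r i = end_bip R r i"
  unfolding bip_at_def next_branch_def by (metis linorder_not_less)

lemma ray_bips_eq: "ray_bips R branch_points r = bip_at r ` bpos r"
proof (intro equalityI subsetI)
  fix p assume "p \<in> ray_bips R branch_points r"
  then consider i j where "i \<in> bpos r" "next_branch r i j" "p = join_bip R r i j"
    | i where "i \<in> bpos r" "\<forall>j\<in>bpos r. j \<le> i" "p = end_bip R r i"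
    unfolding ray_bips_def next_branch_def by blast
  then show "p \<in> bip_at r ` bpos r" by cases (metis bip_at_join bip_at_end imageI)+
next
  fix p assume "p \<in> bip_at r ` bpos r"
  then obtain i where i: "i \<in> bpos r" "p = bip_at r i" by blast
  show "p \<in> ray_bips R branch_points r"
  proof (cases rule: next_branch_cases[of r i])
    case (1 j)
    then show ?thesis using i bip_at_join[OF 1] unfolding ray_bips_def next_branch_def by blast
  next
    case 2
    then show ?thesis using i bip_at_end[OF 2] unfolding ray_bips_def by blast
  qed
qed

text \<open>The construction looks on a ray of stage \<open>n\<close> only for points of
  \<open>B n\<close>; points of another \<open>B m\<close> are new at another stage, so they do not
  occur there at a positive position.\<close>

lemma branch_pos_B:
  assumes "r \<in> rays mid L B R n"
  shows "branch_pos (B n) r = bpos r"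
proof -
  have "n \<ge> 1" using assms by (cases n) auto
  moreover have "m = n" if "1 \<le> i" "r i \<in> B m" "m \<ge> 1" for i m
    using that B_subset[of m] rays_new_vertex[OF assms, of i] level_unique by blast
  ultimately show ?thesis unfolding branch_pos_def branch_points_def by auto
qed

lemma bips_upto_eq:
  "bips_upto mid L B R (Suc n) = insert L (\<Union>m\<in>{..n}. \<Union>r\<in>rays mid L B R m. bip_at r ` bpos r)"
proof (induction n)
  case (Suc n)
  have "ray_bips R (B (Suc n)) r = bip_at r ` bpos r" if "r \<in> rays mid L B R (Suc n)" for r
    using branch_pos_B[OF that] ray_bips_eq[of r] unfolding ray_bips_def by simp
  then have "bips_upto mid L B R (Suc (Suc n)) =
      bips_upto mid L B R (Suc n) \<union> (\<Union>r\<in>rays mid L B R (Suc n). bip_at r ` bpos r)"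
    by (simp cong: SUP_cong)
  then show ?case by (simp only: Suc.IH atMost_Suc UN_insert Un_insert_left Un_insert_right Un_commute)
qed simp

lemma bips_eq: "P = insert L {bip_at r i | r i. r \<in> all_rays \<and> i \<in> bpos r}"
proof -
  have "P = (\<Union>n. bips_upto mid L B R (Suc n))"
    unfolding bips_def
  proof (intro equalityI UN_least)
    fix n show "bips_upto mid L B R n \<subseteq> (\<Union>n. bips_upto mid L B R (Suc n))"
      by (cases n) auto
  qed auto
  also have "\<dots> = insert L {bip_at r i | r i. r \<in> all_rays \<and> i \<in> bpos r}"
    unfolding bips_upto_eq all_rays_def by blast
  finally show ?thesis .
qed

lemma bip_at_nonpos:
  "k \<le> 0 \<Longrightarrow> bip_at r i k = R (r i) (nat (- k))"
  by (cases rule: next_branch_cases[of r i]) (auto simp: bip_at_join bip_at_end join_bip_def end_bip_def)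

section \<open>Directed edges of a bip\<close>

lemma R_not_line_ray:
  assumes "v \<in> branch_points"
  shows "R v (Suc k) \<noteq> L j" "R v \<noteq> pos_ray" "R v \<noteq> neg_ray"
proof -
  obtain n where n: "n \<ge> 1" "v \<in> B n" using assms unfolding branch_points_def by auto
  have *: "R v (Suc k) \<noteq> L j" for k j
    using R_props(3)[OF n, of k] stage_mono[of 1 n] n(1) by auto
  show "R v (Suc k) \<noteq> L j" by (rule *)
  show "R v \<noteq> pos_ray" "R v \<noteq> neg_ray" using * by metis+
qed

lemma bpos_branch_point: "i \<in> bpos r \<Longrightarrow> r i \<in> branch_points \<and> 1 \<le> i"
  by (auto simp: branch_pos_def)

text \<open>The path comes in on the ray at \<open>r i\<close>, follows \<open>r\<close>, and
  possibly leaves on the ray at the next branching point. In terms of \<open>last_branch\<close> the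
  middle part has the same description whether or not it ends.\<close>

lemma arcs_bip_at:
  assumes i: "i \<in> bpos r"
  shows "(x, y) \<in> arcs (bip_at r i) \<longleftrightarrow>
      (\<exists>k. x = R (r i) (Suc k) \<and> y = R (r i) k) \<or>
      (\<exists>k. x = r k \<and> y = r (Suc k) \<and> last_branch r k = Some i) \<or>
      (\<exists>j k. next_branch r i j \<and> x = R (r j) k \<and> y = R (r j) (Suc k))"
    (is "_ \<longleftrightarrow> ?A \<or> ?B \<or> ?C")
proof -
  let ?p = "bip_at r i"
  have ri0: "R (r i) 0 = r i" using R_0 bpos_branch_point[OF i] by blast
  have "(\<exists>k\<ge>0. x = ?p (- k - 1) \<and> y = ?p (- k)) \<longleftrightarrow> (\<exists>k. x = ?p (- int k - 1) \<and> y = ?p (- int k))"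
    by (metis nonneg_int_cases of_nat_0_le_iff)
  also have "\<dots> \<longleftrightarrow> ?A" by (simp add: bip_at_nonpos Suc_nat_eq_nat_zadd1 nat_add_distrib)
  finally have neg: "(\<exists>k\<ge>0. x = ?p (- k - 1) \<and> y = ?p (- k)) \<longleftrightarrow> ?A" .
  have "(\<exists>k\<ge>0. x = ?p k \<and> y = ?p (k + 1)) \<longleftrightarrow> (\<exists>k. x = ?p (int k) \<and> y = ?p (int k + 1))"
    by (metis nonneg_int_cases of_nat_0_le_iff)
  also have "\<dots> \<longleftrightarrow> ?B \<or> ?C"
  proof (cases rule: next_branch_cases[of r i])
    case (1 j)
    then have ij: "i < j" "R (r j) 0 = r j"
      using R_0 bpos_branch_point[of j] unfolding next_branch_def by blast+
    have lb: "last_branch r k = Some i \<longleftrightarrow> i \<le> k \<and> k < j" for k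
      using 1 i unfolding last_branch_Some_iff next_branch_def by (metis linorder_not_less order_le_less_trans)
    \<comment> \<open>At times 0 and \<open>j - i\<close> two pieces of the path meet; they agree
      there because a glued ray starts at its branching point.\<close>
    have p1: "?p (int k) = r (i + k)" if "k \<le> j - i" for k
      using that ri0 ij by (cases k) (auto simp: bip_at_join[OF 1] join_bip_def nat_add_distrib)
    have p2: "?p (int (j - i) + int k) = R (r j) k" for k
      using p1[of "j - i"] ij by (cases k) (auto simp: bip_at_join[OF 1] join_bip_def nat_add_distrib)
    have nb: "next_branch r i j' \<longleftrightarrow> j' = j" for j' using 1 next_branch_unique by blast
    show ?thesis
    proof
      assume "\<exists>k. x = ?p (int k) \<and> y = ?p (int k + 1)"
      then obtain k where k: "x = ?p (int k)" "y = ?p (int k + 1)" by blast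
      show "?B \<or> ?C"
      proof (cases "k < j - i")
        case True
        then have "x = r (i + k)" "y = r (Suc (i + k))"
          using k p1[of k] p1[of "Suc k"] by (auto simp: add.commute)
        then show ?thesis using lb True by (intro disjI1 exI[of _ "i + k"]) auto
      next
        case False
        then have "int k = int (j - i) + int (k - (j - i))"
          "int k + 1 = int (j - i) + int (Suc (k - (j - i)))" by auto
        then have "x = R (r j) (k - (j - i))" "y = R (r j) (Suc (k - (j - i)))"
          using k p2 by metis+
        then show ?thesis using 1 by blast
      qed
    next
      assume "?B \<or> ?C"
      then show "\<exists>k. x = ?p (int k) \<and> y = ?p (int k + 1)"
      proof
        assume ?B
        then obtain k where k: "x = r k" "y = r (Suc k)" "i \<le> k" "k < j" unfolding lb by blast
        then have "x = ?p (int (k - i))" "y = ?p (int (Suc (k - i)))"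
          using p1[of "k - i"] p1[of "Suc (k - i)"] by (auto simp del: of_nat_Suc)
        then show ?thesis by (intro exI[of _ "k - i"]) (simp add: add.commute)
      next
        assume ?C
        then obtain k where k: "x = R (r j) k" "y = R (r j) (Suc k)" unfolding nb by blast
        have "int (j - i + k) = int (j - i) + int k"
          "int (j - i + k) + 1 = int (j - i) + int (Suc k)" by simp_all
        then have "x = ?p (int (j - i + k))" "y = ?p (int (j - i + k) + 1)"
          using k p2[of k] p2[of "Suc k"] by metis+
        then show ?thesis by blast
      qed
    qed
  next
    case 2
    have lb: "last_branch r k = Some i \<longleftrightarrow> i \<le> k" for k
      using 2 i unfolding last_branch_Some_iff by (meson linorder_not_less)
    have p1: "?p (int k) = r (i + k)" for k
      using ri0 by (cases k) (auto simp: bip_at_end[OF 2] end_bip_def nat_add_distrib)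
    have p2: "?p (int k + 1) = r (Suc (i + k))" for k
      using p1[of "Suc k"] by (simp add: add.commute)
    have nb: "\<not> next_branch r i j'" for j' using 2 unfolding next_branch_def by auto
    show ?thesis unfolding p1 p2 lb by (auto simp: nb le_iff_add)
  qed
  finally show ?thesis unfolding arcs_iff neg by blast
qed

text \<open>The incoming part runs a glued ray backwards, so it would yield an edge traversed in
  opposite directions by two rays. By \<open>opposite_edges\<close> both would be line rays, which a
  glued ray is not.\<close>

lemma forward_arc_bip_at:
  assumes "r \<in> all_rays" "i \<in> bpos r" "s \<in> all_rays"
  shows "(s k, s (Suc k)) \<in> arcs (bip_at r i) \<longleftrightarrow>
      s = r \<and> last_branch r k = Some i \<or> (\<exists>j. next_branch r i j \<and> s = R (r j))"
proof -
  have v: "r i \<in> branch_points" using assms bpos_branch_point by blast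
  have "\<not> (s k = R (r i) (Suc m) \<and> s (Suc k) = R (r i) m)" for m
    using opposite_edges[of s "R (r i)" k m] assms R_in_all_rays[OF v] R_not_line_ray[OF v] by blast
  then have 1: "(\<exists>m. s k = R (r i) (Suc m) \<and> s (Suc k) = R (r i) m) \<longleftrightarrow> False" by blast
  have "s = r \<and> k = m" if "s (Suc k) = r (Suc m)" for m
    using ray_coords_unique[of s r "Suc k" "Suc m"] assms that by auto
  then have 2: "(\<exists>m. s k = r m \<and> s (Suc k) = r (Suc m) \<and> last_branch r m = Some i) \<longleftrightarrow>
      s = r \<and> last_branch r k = Some i" by blast
  have "s = R (r j) \<and> k = m" if "next_branch r i j" "s (Suc k) = R (r j) (Suc m)" for j m
    using ray_coords_unique[of s "R (r j)" "Suc k" "Suc m"] assms that R_in_all_rays[of "r j"]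
      bpos_branch_point unfolding next_branch_def by auto
  then have 3: "(\<exists>j m. next_branch r i j \<and> s k = R (r j) m \<and> s (Suc k) = R (r j) (Suc m)) \<longleftrightarrow>
      (\<exists>j. next_branch r i j \<and> s = R (r j))" by blast
  show ?thesis unfolding arcs_bip_at[OF assms(2)] 1 2 3 by simp
qed

lemma backward_arc_bip_at:
  assumes "r \<in> all_rays" "i \<in> bpos r" "s \<in> all_rays"
  shows "(s (Suc k), s k) \<in> arcs (bip_at r i) \<longleftrightarrow> s = R (r i)"
proof -
  have v: "r i \<in> branch_points" using assms bpos_branch_point by blast
  have "s = R (r i)" if "s (Suc k) = R (r i) (Suc m)" for m
    using ray_coords_unique[of s "R (r i)" "Suc k" "Suc m"] assms R_in_all_rays[OF v] that by auto
  then have 1: "(\<exists>m. s (Suc k) = R (r i) (Suc m) \<and> s k = R (r i) m) \<longleftrightarrow> s = R (r i)" by blast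
  \<comment> \<open>Around a suppressed root \<open>s\<close> and \<open>r\<close> can be opposite
    line rays, but only with \<open>m = 0\<close>, and \<open>last_branch r 0\<close> is
    \<open>None\<close>.\<close>
  have 2: "\<not> (\<exists>m. s (Suc k) = r m \<and> s k = r (Suc m) \<and> last_branch r m = Some i)"
    using opposite_edges[of s r k] assms by fastforce
  have "\<not> (s (Suc k) = R (r j) m \<and> s k = R (r j) (Suc m))"
    if "next_branch r i j" for j m
  proof -
    have w: "r j \<in> branch_points" using that bpos_branch_point unfolding next_branch_def by blast
    show ?thesis
      using opposite_edges[of s "R (r j)" k m] assms R_in_all_rays[OF w] R_not_line_ray[OF w] by blast
  qed
  then have 3: "\<not> (\<exists>j m. next_branch r i j \<and> s (Suc k) = R (r j) m \<and> s k = R (r j) (Suc m))"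
    by blast
  show ?thesis unfolding arcs_bip_at[OF assms(2)] 1 using 2 3 by blast
qed

lemma arcs_line:
  assumes "s \<in> all_rays"
  shows "(s k, s (Suc k)) \<in> arcs L \<longleftrightarrow> s = pos_ray" "(s (Suc k), s k) \<in> arcs L \<longleftrightarrow> s = neg_ray"
proof -
  have "((s k, s (Suc k)) \<in> arcs L \<longleftrightarrow> s = pos_ray) \<and> ((s (Suc k), s k) \<in> arcs L \<longleftrightarrow> s = neg_ray)"
    using assms
  proof (cases rule: all_rays_cases)
    case 1
    have "pos_ray \<noteq> neg_ray" by (auto simp: fun_eq_iff intro!: exI[of _ 1])
    then show ?thesis using 1 by (auto simp: arcs_def)
  next
    case 2
    have "neg_ray \<noteq> pos_ray" by (auto simp: fun_eq_iff intro!: exI[of _ 1])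
    then show ?thesis using 2 by (auto simp: arcs_def)
  next
    case (3 v)
    then have "s \<noteq> pos_ray" "s \<noteq> neg_ray" "\<And>j. s (Suc k) \<noteq> L j" using R_not_line_ray by auto
    then show ?thesis by (auto simp: arcs_def)
  qed
  then show "(s k, s (Suc k)) \<in> arcs L \<longleftrightarrow> s = pos_ray" "(s (Suc k), s k) \<in> arcs L \<longleftrightarrow> s = neg_ray"
    by blast+
qed

lemma bip_at_0: "i \<in> bpos r \<Longrightarrow> bip_at r i 0 = r i"
  using bip_at_nonpos[of 0 r i] R_0 bpos_branch_point by simp

text \<open>At time 0 the path is at its branching point, whose coordinates are unique.\<close>

lemma bip_at_eq_iff:
  assumes "r \<in> all_rays" "i \<in> bpos r" "s \<in> all_rays" "j \<in> bpos s"
  shows "bip_at r i = bip_at s j \<longleftrightarrow> r = s \<and> i = j"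
  using bip_at_0[OF assms(2)] bip_at_0[OF assms(4)] ray_coords_unique[of r s i j] assms
    bpos_branch_point by metis

text \<open>At time -1 the path is on a glued ray, off the line.\<close>

lemma bip_at_neq_L:
  assumes "i \<in> bpos r"
  shows "bip_at r i \<noteq> L"
  using bip_at_nonpos[of "-1" r i] R_not_line_ray(1)[of "r i" 0 "-1"] bpos_branch_point[OF assms]
  by auto

lemma last_branch_bpos: "last_branch r k = Some i \<Longrightarrow> i \<in> bpos r"
  by (simp add: last_branch_Some_iff)

end

section \<open>Flows and bi-infinite paths\<close>

locale trivalent_ray_tree = ray_tree V E mid L B R + trivalent_graph V E
  for V :: "'v set" and E mid L B R
begin

section \<open>Conservation at a vertex in ray coordinates\<close>

lemma Kirchhoff_ray:
  fixes c :: "'v list \<Rightarrow> 'a::normed_coeff_ring"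
  assumes c: "c \<in> chains T 1" and r: "r \<in> all_rays"
  shows "(\<Sum>x\<in>nbrs (r (Suc k)). c [x, r (Suc k)]) =
    c [r k, r (Suc k)] - c [r (Suc k), r (Suc (Suc k))] -
    (if r (Suc k) \<in> branch_points then c [R (r (Suc k)) 0, R (r (Suc k)) 1] else 0)"
proof -
  have ne: "r k \<noteq> r (Suc (Suc k))" using ray_inj[OF r] by simp
  have swap: "c [r (Suc (Suc k)), r (Suc k)] = - c [r (Suc k), r (Suc (Suc k))]"
    by (rule chains_1_antisym[OF c])
  show ?thesis
  proof (cases "r (Suc k) \<in> branch_points")
    case False
    then show ?thesis unfolding nbrs_def neighbours_on_ray[OF r] using ne swap by simp
  next
    case True
    let ?v = "r (Suc k)"
    have Rv: "R ?v \<in> all_rays" "R ?v 0 = ?v" using True R_in_all_rays R_0 by auto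
    have "r (Suc (Suc k)) \<noteq> R ?v 1"
      using ray_coords_unique[OF r Rv(1), of "Suc (Suc k)" 1] by auto
    \<comment> \<open>For \<open>k = 0\<close> both rays would cross one edge in opposite
      directions; for \<open>k > 0\<close> unique coordinates give \<open>r = R ?v\<close>, and
      \<open>r\<close> would visit \<open>?v\<close> twice.\<close>
    moreover have "r k \<noteq> R ?v 1"
    proof
      assume eq: "r k = R ?v 1"
      show False
      proof (cases k)
        case 0
        then have "r 0 = R ?v (Suc 0)" "r (Suc 0) = R ?v 0" using eq Rv(2) by simp_all
        from opposite_edges[OF r Rv(1) this] R_not_line_ray(2,3)[OF True] show False by blast
      next
        case (Suc l)
        then have "1 \<le> k" by simp
        then have "r = R ?v" using ray_coords_unique[OF r Rv(1) _ order_refl eq] by blast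
        then have "r 0 = r (Suc k)" using Rv(2) by metis
        then show False using ray_inj[OF r] by simp
      qed
    qed
    moreover have "c [R ?v 1, ?v] = - c [R ?v 0, R ?v 1]"
      using chains_1_antisym[OF c, of "R ?v 1" ?v] Rv by simp
    ultimately show ?thesis
      unfolding nbrs_def neighbours_on_ray[OF r] using ne swap True by (simp add: Rv)
  qed
qed

text \<open>No ray is glued at the root, because a branching point has a position of at least 1 on
  some ray and the root has none. So only the first edges of the line rays meet it.\<close>

lemma Kirchhoff_root:
  fixes c :: "'v list \<Rightarrow> 'a::normed_coeff_ring"
  assumes c: "c \<in> chains T 1" and "\<not> mid"
  shows "(\<Sum>x\<in>nbrs (L 0). c [x, L 0]) = - c [pos_ray 0, pos_ray 1] - c [neg_ray 0, neg_ray 1]"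
proof -
  have "nbrs (L 0) = {L 1, L (- 1)}"
  proof (intro equalityI subsetI)
    fix x assume "x \<in> nbrs (L 0)"
    then have "{x, L 0} \<in> E" unfolding nbrs_def by simp
    then obtain s l where s: "s \<in> all_rays" "{x, L 0} = {s l, s (Suc l)}" unfolding E_eq by auto
    have "s (Suc l) \<noteq> L 0" using root_not_new[OF s(1) \<open>\<not> mid\<close>] by blast
    with s(2) have x: "x = s (Suc l)" "s l = L 0" by (auto simp: doubleton_eq_iff)
    then have "l = 0" using root_not_new[OF s(1) \<open>\<not> mid\<close>] by (cases l) auto
    show "x \<in> {L 1, L (- 1)}" using s(1)
    proof (cases rule: all_rays_cases)
      case (3 v)
      then have "v = L 0" using x \<open>l = 0\<close> R_0 by simp
      then show ?thesis
        using branch_point_coords[OF 3(1)] root_not_new[OF _ \<open>\<not> mid\<close>] by (metis Suc_le_D One_nat_def)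
    qed (use x \<open>l = 0\<close> \<open>\<not> mid\<close> in auto)
  next
    fix x assume "x \<in> {L 1, L (- 1)}"
    then show "x \<in> nbrs (L 0)"
      using ray_edge[OF line_rays(1), of 0] ray_edge[OF line_rays(2), of 0] \<open>\<not> mid\<close>
      unfolding nbrs_def by (auto simp: insert_commute)
  qed
  then show ?thesis
    using chains_1_antisym[OF c, of "L 1" "L 0"] chains_1_antisym[OF c, of "L (- 1)" "L 0"] \<open>\<not> mid\<close>
    by simp
qed

text \<open>The root condition concerns a root that is a vertex. If it is suppressed, the same
  equation is the antisymmetry of the chain on \<open>{L 0, L 1}\<close>.\<close>

lemma cycles_iff:
  fixes c :: "'v list \<Rightarrow> 'a::normed_coeff_ring"
  shows "c \<in> cycles T 1 \<longleftrightarrow> c \<in> chains T 1 \<and>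
    (\<not> mid \<longrightarrow> c [pos_ray 0, pos_ray 1] = - c [neg_ray 0, neg_ray 1]) \<and>
    (\<forall>r\<in>all_rays. \<forall>k. c [r k, r (Suc k)] = c [r (Suc k), r (Suc (Suc k))] +
      (if r (Suc k) \<in> branch_points then c [R (r (Suc k)) 0, R (r (Suc k)) 1] else 0))"
    (is "_ \<longleftrightarrow> _ \<and> ?root \<and> ?ray")
proof (cases "c \<in> chains T 1")
  case True
  have "(\<forall>y. (\<Sum>x\<in>nbrs y. c [x, y]) = 0) \<longleftrightarrow> ?root \<and> ?ray"
  proof
    assume sum0: "\<forall>y. (\<Sum>x\<in>nbrs y. c [x, y]) = 0"
    have ?root using Kirchhoff_root[OF True] sum0 by (simp add: eq_neg_iff_add_eq_0 algebra_simps)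
    moreover have ?ray
    proof (intro ballI allI)
      fix r k assume "r \<in> all_rays"
      then show "c [r k, r (Suc k)] = c [r (Suc k), r (Suc (Suc k))] +
        (if r (Suc k) \<in> branch_points then c [R (r (Suc k)) 0, R (r (Suc k)) 1] else 0)"
        using Kirchhoff_ray[OF True, of r k] sum0[rule_format, of "r (Suc k)"]
        by (simp add: diff_diff_eq)
    qed
    ultimately show "?root \<and> ?ray" by blast
  next
    assume cond: "?root \<and> ?ray"
    show "\<forall>y. (\<Sum>x\<in>nbrs y. c [x, y]) = 0"
    proof
      fix y
      show "(\<Sum>x\<in>nbrs y. c [x, y]) = 0"
      proof (cases "y \<in> V")
        case False
        then have "nbrs y = {}" using edgeD unfolding nbrs_def by blast
        then show ?thesis by simp
      next
        case y: True
        then show ?thesis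
        proof (cases rule: vertex_cases)
          case (1 r k)
          then obtain l where "k = Suc l" by (cases k) auto
          then have "c [r l, r (Suc l)] = c [r (Suc l), r (Suc (Suc l))] +
              (if r (Suc l) \<in> branch_points then c [R (r (Suc l)) 0, R (r (Suc l)) 1] else 0)"
            using cond 1 by blast
          then show ?thesis using Kirchhoff_ray[OF True 1(1), of l] 1 \<open>k = Suc l\<close>
            by (simp add: diff_diff_eq)
        next
          case 2
          have "c [pos_ray 0, pos_ray 1] = - c [neg_ray 0, neg_ray 1]" using cond 2 by blast
          then show ?thesis using Kirchhoff_root[OF True] 2 by simp
        qed
      qed
    qed
  qed
  then show ?thesis unfolding cycles_graph_iff using True by blast
qed (simp add: cycles_def)

text \<open>What the bip travelling along \<open>r\<close> contributes at position \<open>k\<close>,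
  as opposed to the bips that contain all of \<open>r\<close>.\<close>

definition branch_term :: "((int \<Rightarrow> 'v) \<Rightarrow> 'a::normed_coeff_ring) \<Rightarrow> (nat \<Rightarrow> 'v) \<Rightarrow> nat \<Rightarrow> 'a" where
  "branch_term f r k = (case last_branch r k of None \<Rightarrow> 0 | Some i \<Rightarrow> f (bip_at r i))"

lemma branch_term_0: "branch_term f r 0 = 0"
  by (simp add: branch_term_def)

lemma branch_term_Suc:
  "branch_term f r (Suc k) = (if r (Suc k) \<in> branch_points then f (bip_at r (Suc k)) else branch_term f r k)"
  by (simp add: branch_term_def)

section \<open>The bips over an edge\<close>

lemma ray_edge_in_bip:
  assumes "r \<in> all_rays" "i \<in> bpos r" "s \<in> all_rays"
  shows "{s k, s (Suc k)} \<in> bip_edges (bip_at r i) \<longleftrightarrow>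
    s = r \<and> last_branch r k = Some i \<or> (\<exists>j. next_branch r i j \<and> s = R (r j)) \<or> s = R (r i)"
  unfolding bip_edges_arcs forward_arc_bip_at[OF assms] backward_arc_bip_at[OF assms] by blast

lemma R_eq_iff: "v \<in> branch_points \<Longrightarrow> w \<in> branch_points \<Longrightarrow> R v = R w \<longleftrightarrow> v = w"
  using R_0 by metis

lemma next_branch_point: "next_branch r i j \<Longrightarrow> r j \<in> branch_points"
  using bpos_branch_point unfolding next_branch_def by blast

lemma L_in_P: "L \<in> P" and bip_at_in_P: "r \<in> all_rays \<Longrightarrow> i \<in> bpos r \<Longrightarrow> bip_at r i \<in> P"
  unfolding bips_eq by auto

lemma P_cases:
  assumes "p \<in> P"
  obtains "p = L" | r i where "r \<in> all_rays" "i \<in> bpos r" "p = bip_at r i"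
  using assms unfolding bips_eq by auto

lemma bips_over_line:
  assumes "s = pos_ray \<or> s = neg_ray"
  shows "{p \<in> P. {s k, s (Suc k)} \<in> bip_edges p} = insert L (bip_at s ` set_option (last_branch s k))"
proof -
  have s: "s \<in> all_rays" using assms line_rays by blast
  have ne: "s \<noteq> R v" if "v \<in> branch_points" for v using R_not_line_ray[OF that] assms by auto
  have L: "{s k, s (Suc k)} \<in> bip_edges L" using assms unfolding bip_edges_arcs arcs_line[OF s] .
  have bip: "{s k, s (Suc k)} \<in> bip_edges (bip_at r i) \<longleftrightarrow> s = r \<and> last_branch r k = Some i"
    if "r \<in> all_rays" "i \<in> bpos r" for r i
    using ne next_branch_point bpos_branch_point[OF that(2)]
    unfolding ray_edge_in_bip[OF that s] by blast
  show ?thesis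
  proof (intro equalityI subsetI)
    fix p assume "p \<in> {p \<in> P. {s k, s (Suc k)} \<in> bip_edges p}"
    then have p: "p \<in> P" "{s k, s (Suc k)} \<in> bip_edges p" by auto
    from p(1) show "p \<in> insert L (bip_at s ` set_option (last_branch s k))"
      by (cases rule: P_cases) (use bip p(2) in auto)
  next
    fix p assume "p \<in> insert L (bip_at s ` set_option (last_branch s k))"
    then show "p \<in> {p \<in> P. {s k, s (Suc k)} \<in> bip_edges p}"
      using L bip[OF s last_branch_bpos] L_in_P bip_at_in_P[OF s last_branch_bpos] by auto
  qed
qed

text \<open>At most three bips: the one coming in along \<open>s\<close>, the one going out along
  \<open>s\<close> if \<open>r\<close> has an earlier branching point, and the one travelling along
  \<open>s\<close> from the last branching point before the edge.\<close>

lemma bips_over_branch: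
  assumes r: "r \<in> all_rays" and v: "r (Suc i) \<in> branch_points" and s_def: "s = R (r (Suc i))"
  shows "{p \<in> P. {s k, s (Suc k)} \<in> bip_edges p} =
    insert (bip_at r (Suc i)) (bip_at r ` set_option (last_branch r i) \<union> bip_at s ` set_option (last_branch s k))"
proof -
  have s: "s \<in> all_rays" using v R_in_all_rays s_def by blast
  have si: "Suc i \<in> bpos r" using v by (simp add: branch_pos_def)
  have L: "{s k, s (Suc k)} \<notin> bip_edges L"
    using R_not_line_ray[OF v] arcs_line[OF s] s_def by (simp add: bip_edges_arcs)
  have bip: "{s k, s (Suc k)} \<in> bip_edges (bip_at q j) \<longleftrightarrow>
      s = q \<and> last_branch s k = Some j \<or> q = r \<and> (last_branch r i = Some j \<or> j = Suc i)"
    if q: "q \<in> all_rays" "j \<in> bpos q" for q j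
  proof -
    have "s = R (q j) \<longleftrightarrow> q = r \<and> j = Suc i"
      using R_eq_iff[OF v] bpos_branch_point[OF q(2)] ray_coords_unique[OF r q(1), of "Suc i" j]
      unfolding s_def by auto
    \<comment> \<open>A path that goes out along \<open>s\<close> comes in at the branching point
      just before \<open>r (Suc i)\<close> on \<open>r\<close>.\<close>
    moreover have "(\<exists>m. next_branch q j m \<and> s = R (q m)) \<longleftrightarrow> q = r \<and> last_branch r i = Some j"
    proof
      assume "\<exists>m. next_branch q j m \<and> s = R (q m)"
      then obtain m where m: "next_branch q j m" "s = R (q m)" by blast
      then have "q m = r (Suc i)" using R_eq_iff[OF v] next_branch_point unfolding s_def by auto
      moreover have "m \<ge> 1" using m(1) bpos_branch_point unfolding next_branch_def by blast
      ultimately have "q = r \<and> m = Suc i" using ray_coords_unique[OF q(1) r, of m "Suc i"] by auto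
      then show "q = r \<and> last_branch r i = Some j" using m next_branch_iff q(2) by blast
    next
      assume "q = r \<and> last_branch r i = Some j"
      then show "\<exists>m. next_branch q j m \<and> s = R (q m)"
        using next_branch_iff[OF q(2), of i] v s_def by blast
    qed
    ultimately show ?thesis unfolding ray_edge_in_bip[OF q s] by blast
  qed
  show ?thesis (is "?C = ?D")
  proof (intro equalityI subsetI)
    fix p assume "p \<in> ?C"
    then have p: "p \<in> P" "{s k, s (Suc k)} \<in> bip_edges p" by auto
    from p(1) show "p \<in> ?D" by (cases rule: P_cases) (use L bip p(2) in auto)
  next
    fix p assume "p \<in> ?D"
    then consider "p = bip_at r (Suc i)" | j where "last_branch r i = Some j" "p = bip_at r j"
      | j where "last_branch s k = Some j" "p = bip_at s j" by auto
    then show "p \<in> ?C"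
      by cases (use bip[OF r] bip[OF s] bip_at_in_P[OF r] bip_at_in_P[OF s] si last_branch_bpos in auto)
  qed
qed

lemma ray_neq_R:
  assumes "r \<in> all_rays" "i \<in> bpos r"
  shows "r \<noteq> R (r i)"
proof
  assume "r = R (r i)"
  then have "r 0 = r i" using R_0 bpos_branch_point[OF assms(2)] by metis
  then show False using ray_inj[OF assms(1)] bpos_branch_point[OF assms(2)] by auto
qed

text \<open>\<open>bip_chain\<close> tests the forward direction first, so its sign is right on
  backward edges only if no edge is crossed both ways. This holds because the ray on which a bip
  comes in differs from those it uses afterwards.\<close>

lemma not_forward_and_backward:
  assumes "r \<in> all_rays" "i \<in> bpos r" "s \<in> all_rays"
  shows "(s k, s (Suc k)) \<notin> arcs (bip_at r i) \<or> (s (Suc k), s k) \<notin> arcs (bip_at r i)"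
proof -
  have "r \<noteq> R (r i)" by (rule ray_neq_R[OF assms(1,2)])
  moreover have "R (r j) \<noteq> R (r i)" if "next_branch r i j" for j
    using that R_eq_iff next_branch_point[OF that] bpos_branch_point[OF assms(2)] ray_inj[OF assms(1)]
    unfolding next_branch_def by auto
  ultimately show ?thesis
    unfolding forward_arc_bip_at[OF assms] backward_arc_bip_at[OF assms] by metis
qed

section \<open>The flow of a function on the bips\<close>

lemma bip_chain_bip_at:
  assumes "r \<in> all_rays" "i \<in> bpos r" "s \<in> all_rays"
  shows "bip_chain (bip_at r i) [s k, s (Suc k)] =
    (if s = R (r i) then - 1
     else if s = r \<and> last_branch r k = Some i \<or> (\<exists>j. next_branch r i j \<and> s = R (r j)) then 1 else 0)"
  using not_forward_and_backward[OF assms, of k]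
  unfolding bip_chain_arcs forward_arc_bip_at[OF assms] backward_arc_bip_at[OF assms] by auto

lemma bip_sum_line:
  fixes f :: "(int \<Rightarrow> 'v) \<Rightarrow> 'a::normed_coeff_ring"
  shows "bip_sum P f [pos_ray k, pos_ray (Suc k)] = f L + branch_term f pos_ray k"
    and "bip_sum P f [neg_ray k, neg_ray (Suc k)] = - f L + branch_term f neg_ray k"
proof -
  have *: "bip_sum P f [s k, s (Suc k)] = f L * bip_chain L [s k, s (Suc k)] + branch_term f s k"
    if s: "s = pos_ray \<or> s = neg_ray" for s
  proof -
    have s': "s \<in> all_rays" using s line_rays by blast
    have chain: "bip_chain (bip_at s i) [s k, s (Suc k)] = (1 :: 'a)" if "last_branch s k = Some i" for i
      using that bip_chain_bip_at[OF s' _ s'] last_branch_bpos s R_not_line_ray bpos_branch_point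
      by (metis (no_types, lifting))
    have "L \<noteq> bip_at s i" if "last_branch s k = Some i" for i
      using bip_at_neq_L[OF last_branch_bpos[OF that]] by simp
    then show ?thesis
      using chain bips_over_line[OF s, of k]
      by (cases "last_branch s k") (simp_all add: bip_sum_def branch_term_def)
  qed
  have ne: "pos_ray \<noteq> neg_ray" by (auto simp: fun_eq_iff intro!: exI[of _ 1])
  show "bip_sum P f [pos_ray k, pos_ray (Suc k)] = f L + branch_term f pos_ray k"
    using *[of pos_ray] arcs_line(1)[OF line_rays(1), of k] by (simp add: bip_chain_arcs)
  have "(neg_ray k, neg_ray (Suc k)) \<notin> arcs L" "(neg_ray (Suc k), neg_ray k) \<in> arcs L"
    using arcs_line[OF line_rays(2), of k] ne by metis+
  then have "bip_chain L [neg_ray k, neg_ray (Suc k)] = (- 1 :: 'a)" unfolding bip_chain_arcs by simp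
  then show "bip_sum P f [neg_ray k, neg_ray (Suc k)] = - f L + branch_term f neg_ray k"
    using *[of neg_ray] by simp
qed

lemma bip_sum_branch:
  fixes f :: "(int \<Rightarrow> 'v) \<Rightarrow> 'a::normed_coeff_ring"
  assumes r: "r \<in> all_rays" and v: "r (Suc i) \<in> branch_points" and s_def: "s = R (r (Suc i))"
  shows "bip_sum P f [s k, s (Suc k)] = branch_term f r i - f (bip_at r (Suc i)) + branch_term f s k"
proof -
  have s: "s \<in> all_rays" using v R_in_all_rays s_def by blast
  have si: "Suc i \<in> bpos r" using v by (simp add: branch_pos_def)
  have ne: "s \<noteq> r" using s_def ray_neq_R[OF r si] by auto
  have c0: "bip_chain (bip_at r (Suc i)) [s k, s (Suc k)] = (- 1 :: 'a)"
    using bip_chain_bip_at[OF r si s] s_def by simp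
  have c1: "bip_chain (bip_at r j) [s k, s (Suc k)] = (1 :: 'a)" if "last_branch r i = Some j" for j
  proof -
    have j: "j \<in> bpos r" "j \<le> i" using that unfolding last_branch_Some_iff by auto
    then have "s \<noteq> R (r j)"
      using s_def R_eq_iff[OF v] bpos_branch_point[OF j(1)] ray_inj[OF r] by auto
    moreover have "next_branch r j (Suc i)" using next_branch_iff[OF j(1)] v that by blast
    ultimately show ?thesis unfolding bip_chain_bip_at[OF r j(1) s] using s_def by auto
  qed
  have c2: "bip_chain (bip_at s j) [s k, s (Suc k)] = (1 :: 'a)" if "last_branch s k = Some j" for j
  proof -
    have j: "j \<in> bpos s" using that last_branch_bpos by blast
    have "s \<noteq> R (s j)" by (rule ray_neq_R[OF s j])
    then show ?thesis using that by (simp add: bip_chain_bip_at[OF s j s])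
  qed
  \<comment> \<open>The bips over the edge are pairwise distinct, so the sum over this set has a
    summand for each.\<close>
  have d1: "bip_at r (Suc i) \<noteq> bip_at r j" if "last_branch r i = Some j" for j
    using that bip_at_eq_iff[OF r si r] unfolding last_branch_Some_iff by auto
  have d2: "bip_at r m \<noteq> bip_at s j" if "last_branch s k = Some j" "m \<in> bpos r" for j m
    using that bip_at_eq_iff[OF r _ s] ne last_branch_bpos by blast
  have d3: "bip_at s j \<noteq> bip_at r m" if "last_branch s k = Some j" "last_branch r i = Some m" for j m
    using d2[OF that(1) last_branch_bpos[OF that(2)]] by simp
  show ?thesis
    using bips_over_branch[OF assms, of k] c0 c1 c2 d1 d2[OF _ si] d3
    by (cases "last_branch r i"; cases "last_branch s k") (auto simp: bip_sum_def branch_term_def)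
qed

text \<open>At position 0 the \<open>branch_term\<close> vanishes, so the first edge carries exactly
  the contribution of the bips that contain all of \<open>r\<close>.\<close>

lemma bip_sum_ray:
  fixes f :: "(int \<Rightarrow> 'v) \<Rightarrow> 'a::normed_coeff_ring"
  assumes "r \<in> all_rays"
  shows "bip_sum P f [r k, r (Suc k)] = bip_sum P f [r 0, r 1] + branch_term f r k"
  using assms
proof (cases rule: all_rays_cases)
  case 1
  then show ?thesis using bip_sum_line(1)[of f k] bip_sum_line(1)[of f 0] by (simp add: branch_term_0)
next
  case 2
  then show ?thesis using bip_sum_line(2)[of f k] bip_sum_line(2)[of f 0] by (simp add: branch_term_0)
next
  case (3 v)
  then obtain s i where s: "s \<in> all_rays" "v = s (Suc i)"
    using branch_point_coords[of v] by (metis One_nat_def Suc_le_D)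
  show ?thesis
    using bip_sum_branch[of s i r f k] bip_sum_branch[of s i r f 0] s 3 by (simp add: branch_term_0)
qed

lemma arc_in_E:
  assumes "p \<in> P" "(x, y) \<in> arcs p"
  shows "{x, y} \<in> E"
  using assms(1)
proof (cases rule: P_cases)
  case 1
  then have "{x, y} \<in> stage_edges L B R (Suc 0)" using assms(2) unfolding arcs_def by auto
  then show ?thesis unfolding E_eq_stages by blast
next
  case (2 r i)
  have "r i \<in> branch_points" using bpos_branch_point[OF 2(2)] by blast
  then have Ri: "{R (r i) k, R (r i) (Suc k)} \<in> E" for k using ray_edge R_in_all_rays by blast
  have Rj: "{R (r j) k, R (r j) (Suc k)} \<in> E" if "next_branch r i j" for j k
    using ray_edge R_in_all_rays next_branch_point[OF that] by blast
  show ?thesis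
    using assms(2) ray_edge[OF 2(1)] Ri Rj unfolding 2(3) arcs_bip_at[OF 2(2)]
    by (auto simp: insert_commute)
qed

lemma edge_ray_cases:
  assumes "{x, y} \<in> E"
  obtains s k where "s \<in> all_rays" "x = s k" "y = s (Suc k)"
    | s k where "s \<in> all_rays" "x = s (Suc k)" "y = s k"
proof -
  obtain s k where "s \<in> all_rays" "{x, y} = {s k, s (Suc k)}" using assms unfolding E_eq by auto
  then show ?thesis using that by (auto simp: doubleton_eq_iff)
qed

lemma arcs_antisym:
  assumes p: "p \<in> P" and xy: "(x, y) \<in> arcs p"
  shows "(y, x) \<notin> arcs p"
proof -
  have *: "(s k, s (Suc k)) \<notin> arcs p \<or> (s (Suc k), s k) \<notin> arcs p" if s: "s \<in> all_rays" for s k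
    using p
  proof (cases rule: P_cases)
    case 1
    have "pos_ray \<noteq> neg_ray" by (auto simp: fun_eq_iff intro!: exI[of _ 1])
    then show ?thesis unfolding 1 arcs_line[OF s] by auto
  next
    case (2 r i)
    then show ?thesis using not_forward_and_backward[OF 2(1,2) s] by blast
  qed
  show ?thesis
    by (rule edge_ray_cases[OF arc_in_E[OF p xy]]) (use * xy in auto)
qed

lemma bip_sum_antisym:
  fixes f :: "(int \<Rightarrow> 'v) \<Rightarrow> 'a::normed_coeff_ring"
  shows "bip_sum P f [y, x] = - bip_sum P f [x, y]"
proof -
  have "bip_chain p [y, x] = (- bip_chain p [x, y] :: 'a)" if "p \<in> P" for p
    using arcs_antisym[OF that] by (auto simp: bip_chain_arcs)
  then show ?thesis
    unfolding bip_sum_def by (auto simp: insert_commute simp flip: sum_negf intro!: sum.cong)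
qed

lemma bip_sum_nonzero:
  fixes f :: "(int \<Rightarrow> 'v) \<Rightarrow> 'a::normed_coeff_ring"
  assumes "bip_sum P f xs \<noteq> 0"
  shows "\<exists>x y. xs = [x, y] \<and> {x, y} \<in> E"
proof -
  obtain p where p: "p \<in> P" "bip_chain p xs \<noteq> (0 :: 'a)"
    using assms unfolding bip_sum_def
    by (metis (mono_tags, lifting) mem_Collect_eq mult_zero_right sum.neutral)
  then obtain x y where xy: "xs = [x, y]" unfolding bip_chain_def by (auto split: if_splits)
  then have "(x, y) \<in> arcs p \<or> (y, x) \<in> arcs p" using p(2) by (auto simp: bip_chain_arcs split: if_splits)
  then have "{x, y} \<in> E" using arc_in_E[OF p(1)] by (metis insert_commute)
  with xy show ?thesis by blast
qed

text \<open>The 3 is the bound on the number of bips over an edge: a value of the flow has at most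
  three summands, and two on the line.\<close>

lemma cnorm_bip_sum:
  fixes f :: "(int \<Rightarrow> 'v) \<Rightarrow> 'a::normed_coeff_ring"
  assumes "\<And>p. cnorm (f p) \<le> M"
  shows "cnorm (bip_sum P f xs) \<le> 3 * M"
proof -
  have M0: "0 \<le> M" using assms[of L] cnorm_nonneg[of "f L"] by linarith
  have bt: "cnorm (branch_term f r k) \<le> M" for r k
    using assms M0 unfolding branch_term_def by (auto split: option.split)
  have *: "cnorm (bip_sum P f [s k, s (Suc k)]) \<le> 3 * M" if "s \<in> all_rays" for s k
    using that
  proof (cases rule: all_rays_cases)
    case 1
    then show ?thesis
      using bip_sum_line(1)[of f k] cnorm_add[of "f L" "branch_term f s k"] assms[of L] bt[of s k] M0 by simp
  next
    case 2
    then show ?thesis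
      using bip_sum_line(2)[of f k] cnorm_add[of "- f L" "branch_term f s k"] assms[of L] bt[of s k] M0 by simp
  next
    case (3 v)
    then obtain r i where r: "r \<in> all_rays" "v = r (Suc i)"
      using branch_point_coords[of v] by (metis One_nat_def Suc_le_D)
    have "bip_sum P f [s k, s (Suc k)] = branch_term f r i - f (bip_at r (Suc i)) + branch_term f s k"
      using bip_sum_branch[of r i s f k] r 3 by simp
    moreover have "cnorm (branch_term f r i - f (bip_at r (Suc i)) + branch_term f s k) \<le>
        cnorm (branch_term f r i) + cnorm (f (bip_at r (Suc i))) + cnorm (branch_term f s k)"
      by (rule order_trans[OF cnorm_add add_right_mono[OF cnorm_diff]])
    ultimately show ?thesis using bt[of r i] assms[of "bip_at r (Suc i)"] bt[of s k] by simp
  qed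
  show ?thesis
  proof (cases "bip_sum P f xs = 0")
    case False
    then obtain x y where xy: "xs = [x, y]" "{x, y} \<in> E" using bip_sum_nonzero by blast
    from xy(2) show ?thesis
    proof (cases rule: edge_ray_cases)
      case (1 s k)
      then show ?thesis using * xy by simp
    next
      case (2 s k)
      then show ?thesis using *[OF 2(1), of k] xy bip_sum_antisym[of f "s (Suc k)" "s k"] by simp
    qed
  qed (use M0 in simp)
qed

lemma bip_sum_cycle:
  fixes f :: "(int \<Rightarrow> 'v) \<Rightarrow> 'a::normed_coeff_ring"
  assumes "bounded_fun f"
  shows "bip_sum P f \<in> cycles T 1"
proof -
  obtain M where "\<And>p. cnorm (f p) \<le> M" using assms unfolding bounded_fun_def by blast
  then have "bounded_fun (bip_sum P f)" unfolding bounded_fun_def using cnorm_bip_sum by blast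
  moreover have "\<exists>x y. xs = [x, y] \<and> x \<noteq> y \<and> {x, y} \<in> T" if "bip_sum P f xs \<noteq> 0" for xs
    using bip_sum_nonzero[OF that] edgeD edge_graph_complex by blast
  ultimately have "bip_sum P f \<in> chains T 1" by (intro chains_1I bip_sum_antisym)
  moreover have "bip_sum P f [pos_ray 0, pos_ray 1] = - bip_sum P f [neg_ray 0, neg_ray 1]"
    using bip_sum_line[of f 0] by (simp add: branch_term_0)
  \<comment> \<open>The ray glued at a branching point carries off the change of
    \<open>branch_term\<close> there; elsewhere \<open>branch_term\<close> does not change.\<close>
  moreover have "bip_sum P f [r k, r (Suc k)] = bip_sum P f [r (Suc k), r (Suc (Suc k))] +
      (if r (Suc k) \<in> branch_points then bip_sum P f [R (r (Suc k)) 0, R (r (Suc k)) 1] else 0)"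
    if r: "r \<in> all_rays" for r k
    using bip_sum_branch[OF r _ refl, of k f 0]
    unfolding bip_sum_ray[OF r, of f k] bip_sum_ray[OF r, of f "Suc k"] branch_term_Suc
    by (simp add: branch_term_0)
  ultimately show ?thesis unfolding cycles_iff by blast
qed

section \<open>Additivity and bijectivity\<close>

lemma bip_sum_add: "bip_sum P (\<lambda>p. f p + g p) = (\<lambda>xs. bip_sum P f xs + bip_sum P g xs)"
  unfolding bip_sum_def by (auto simp: sum.distrib distrib_right)

text \<open>A branching position is its own last branching position, so \<open>branch_term\<close>
  at \<open>i\<close> is the value on \<open>bip_at r i\<close>; by \<open>bip_sum_ray\<close> the
  flow determines it.\<close>

lemma bip_sum_inj:
  fixes f g :: "(int \<Rightarrow> 'v) \<Rightarrow> 'a::normed_coeff_ring"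
  assumes eq: "bip_sum P f = bip_sum P g" and "p \<in> P"
  shows "f p = g p"
  using \<open>p \<in> P\<close>
proof (cases rule: P_cases)
  case 1
  then show ?thesis using bip_sum_line(1)[of f 0] bip_sum_line(1)[of g 0] eq by (simp add: branch_term_0)
next
  case (2 r i)
  have i: "last_branch r i = Some i" using 2(2) unfolding last_branch_Some_iff by auto
  then have "branch_term f r i = branch_term g r i"
    using bip_sum_ray[OF 2(1), of f i] bip_sum_ray[OF 2(1), of g i] eq by simp
  then show ?thesis using i 2 unfolding branch_term_def by simp
qed

lemma bip_sum_surj:
  fixes c :: "'v list \<Rightarrow> 'a::normed_coeff_ring"
  assumes c: "c \<in> cycles T 1"
  obtains f where "bounded_fun f" "\<And>p. p \<notin> P \<Longrightarrow> f p = 0" "bip_sum P f = c"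
proof -
  have chain: "c \<in> chains T 1"
    and root: "\<not> mid \<Longrightarrow> c [pos_ray 0, pos_ray 1] = - c [neg_ray 0, neg_ray 1]"
    and ray: "\<And>r k. r \<in> all_rays \<Longrightarrow> c [r k, r (Suc k)] = c [r (Suc k), r (Suc (Suc k))] +
      (if r (Suc k) \<in> branch_points then c [R (r (Suc k)) 0, R (r (Suc k)) 1] else 0)"
    using c unfolding cycles_iff by blast+
  obtain M where M: "M \<ge> 0" "\<And>xs. cnorm (c xs) \<le> M"
    using chain bounded_fun_pos unfolding chains_def by blast
  \<comment> \<open>What the bip along \<open>r\<close> has to contribute at position
    \<open>i\<close>: the flow there minus the part due to the bips that contain all of
    \<open>r\<close>, which is seen on the first edge.\<close>
  define val where "val = (\<lambda>(r, i). c [r i, r (Suc i)] - c [r 0, r 1])"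
  define D where "D = {(r, i). r \<in> all_rays \<and> i \<in> bpos r}"
  \<comment> \<open>\<open>bip_at\<close> is injective on \<open>D\<close>, so
    \<open>inv_into\<close> recovers the coordinates of a bip; \<open>L\<close> is split off because
    it has none.\<close>
  define f where "f p = (if p = L then c [L 0, L 1] else if p \<in> P then
    val (inv_into D (\<lambda>(r, i). bip_at r i) p) else 0)" for p
  have fL: "f L = c [L 0, L 1]" by (simp add: f_def)
  have f_bip: "f (bip_at r i) = c [r i, r (Suc i)] - c [r 0, r 1]" if "r \<in> all_rays" "i \<in> bpos r" for r i
  proof -
    have "inj_on (\<lambda>(r, i). bip_at r i) D"
      unfolding D_def inj_on_def using bip_at_eq_iff by auto
    then have "inv_into D (\<lambda>(r, i). bip_at r i) (bip_at r i) = (r, i)"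
      using inv_into_f_f[of "\<lambda>(r, i). bip_at r i" D "(r, i)"] that unfolding D_def by simp
    then show ?thesis using that bip_at_neq_L bip_at_in_P by (simp add: f_def val_def)
  qed
  have val_bound: "cnorm (val x) \<le> M + M" for x
    unfolding val_def case_prod_beta by (rule order_trans[OF cnorm_diff add_mono[OF M(2) M(2)]])
  have "cnorm (f p) \<le> M + M" for p
    using val_bound M(1) M(2)[of "[L 0, L 1]"] by (auto simp: f_def)
  then have bounded: "bounded_fun f" unfolding bounded_fun_def by blast
  \<comment> \<open>Proved from \<open>c\<close> alone and for all rays at once. The first edge of a
    glued ray is then computed from the ray that carries it, without an induction over the
    stages.\<close>
  have bt: "branch_term f r k = c [r k, r (Suc k)] - c [r 0, r 1]" if r: "r \<in> all_rays" for r k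
  proof (induction k)
    case (Suc k)
    show ?case
    proof (cases "r (Suc k) \<in> branch_points")
      case True
      then have "Suc k \<in> bpos r" by (simp add: branch_pos_def)
      then show ?thesis using True f_bip[OF r] by (simp add: branch_term_Suc)
    next
      case False
      then show ?thesis using Suc ray[OF r, of k] by (simp add: branch_term_Suc)
    qed
  qed (simp add: branch_term_0)
  have base: "bip_sum P f [r 0, r 1] = c [r 0, r 1]" if "r \<in> all_rays" for r
    using that
  proof (cases rule: all_rays_cases)
    case 1
    then show ?thesis using bip_sum_line(1)[of f 0] fL by (simp add: branch_term_0)
  next
    case 2
    \<comment> \<open>Two reasons for one equation: the line rays share this edge if the root is
      suppressed, and otherwise conservation at the root links their first edges.\<close>
    have "c [neg_ray 0, neg_ray 1] = - c [L 0, L 1]"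
    proof (cases mid)
      case True
      then show ?thesis using chains_1_antisym[OF chain, of "L 1" "L 0"] by simp
    next
      case False
      then show ?thesis using root by simp
    qed
    then show ?thesis using 2 bip_sum_line(2)[of f 0] fL by (simp add: branch_term_0)
  next
    case (3 v)
    then obtain s i where s: "s \<in> all_rays" "v = s (Suc i)"
      using branch_point_coords[of v] by (metis One_nat_def Suc_le_D)
    then have v: "s (Suc i) \<in> branch_points" "Suc i \<in> bpos s" using 3 by (auto simp: branch_pos_def)
    have "bip_sum P f [r 0, r 1] = branch_term f s i - f (bip_at s (Suc i))"
      using bip_sum_branch[of s i r f 0] s 3 by (simp add: branch_term_0)
    also have "\<dots> = c [s i, s (Suc i)] - c [s (Suc i), s (Suc (Suc i))]"
      using bt[OF s(1)] f_bip[OF s(1) v(2)] by simp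
    also have "\<dots> = c [r 0, r 1]" using ray[OF s(1), of i] v 3 s by simp
    finally show ?thesis .
  qed
  have on_rays: "bip_sum P f [r k, r (Suc k)] = c [r k, r (Suc k)]" if "r \<in> all_rays" for r k
    using bip_sum_ray[OF that, of f k] base[OF that] bt[OF that, of k] by simp
  have "bip_sum P f = c"
  proof
    fix xs
    show "bip_sum P f xs = c xs"
    proof (cases "\<exists>x y. xs = [x, y] \<and> {x, y} \<in> E")
      case True
      then obtain x y where xy: "xs = [x, y]" "{x, y} \<in> E" by blast
      from xy(2) show ?thesis
      proof (cases rule: edge_ray_cases)
        case (1 s k)
        then show ?thesis using on_rays xy by simp
      next
        case (2 s k)
        then show ?thesis
          using on_rays[OF 2(1), of k] xy bip_sum_antisym[of f "s (Suc k)" "s k"]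
            chains_1_antisym[OF chain, of "s (Suc k)" "s k"] by simp
      qed
    next
      case False
      then have "bip_sum P f xs = 0" using bip_sum_nonzero by blast
      moreover have "c xs = 0" using False chains_1D[OF chain, of xs] edge_graph_complex by blast
      ultimately show ?thesis by simp
    qed
  qed
  moreover have "f p = 0" if "p \<notin> P" for p using that L_in_P unfolding f_def by auto
  ultimately show ?thesis using that bounded by blast
qed

section \<open>The isomorphism on homology and its norm bounds\<close>

lemma bip_map_eq: "bip_map V E P f = {bip_sum P f :: 'v list \<Rightarrow> 'a::normed_coeff_ring}"
  unfolding bip_map_def by (rule hclass_graph)

lemma bip_map_iso:
  "(bip_map V E P :: ((int \<Rightarrow> 'v) \<Rightarrow> 'a::normed_coeff_ring) \<Rightarrow> _) \<in> iso (linf P) (H_suf T 1)"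
proof (rule isoI)
  let ?F = "bip_map V E P :: ((int \<Rightarrow> 'v) \<Rightarrow> 'a) \<Rightarrow> _"
  have carrier: "carrier (linf P) = {f :: (int \<Rightarrow> 'v) \<Rightarrow> 'a. (\<forall>x. x \<notin> P \<longrightarrow> f x = 0) \<and> bounded_fun f}"
    unfolding linf_def fun_group_def by simp
  have H: "carrier (H_suf T 1) = (\<lambda>c :: 'v list \<Rightarrow> 'a. {c}) ` cycles T 1"
    unfolding graph.carrier_H_suf hclass_graph ..
  show "?F \<in> hom (linf P) (H_suf T 1)"
  proof (rule homI)
    fix f :: "(int \<Rightarrow> 'v) \<Rightarrow> 'a" assume "f \<in> carrier (linf P)"
    then show "?F f \<in> carrier (H_suf T 1)" unfolding H bip_map_eq using bip_sum_cycle carrier by blast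
  next
    fix f g :: "(int \<Rightarrow> 'v) \<Rightarrow> 'a" assume "f \<in> carrier (linf P)" "g \<in> carrier (linf P)"
    then have "bip_sum P f \<in> cycles T 1" "bip_sum P g \<in> cycles T 1" using bip_sum_cycle carrier by auto
    then show "?F (f \<otimes>\<^bsub>linf P\<^esub> g) = ?F f \<otimes>\<^bsub>H_suf T 1\<^esub> ?F g"
      unfolding bip_map_def using graph.H_suf_mult[of "bip_sum P f" 1 "bip_sum P g"]
      by (simp add: linf_def fun_group_def bip_sum_add)
  qed
  show "bij_betw ?F (carrier (linf P)) (carrier (H_suf T 1))"
  proof (rule bij_betw_imageI)
    show "inj_on ?F (carrier (linf P))"
    proof (rule inj_onI)
      fix f g :: "(int \<Rightarrow> 'v) \<Rightarrow> 'a"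
      assume fg: "f \<in> carrier (linf P)" "g \<in> carrier (linf P)" "?F f = ?F g"
      then have eq: "bip_sum P f = bip_sum P g" unfolding bip_map_eq by simp
      show "f = g"
      proof
        fix p show "f p = g p"
          using bip_sum_inj[OF eq] fg(1,2) carrier by (cases "p \<in> P") auto
      qed
    qed
    show "?F ` carrier (linf P) = carrier (H_suf T 1)"
    proof (intro equalityI subsetI)
      fix X assume "X \<in> ?F ` carrier (linf P)"
      then show "X \<in> carrier (H_suf T 1)" unfolding H bip_map_eq using bip_sum_cycle carrier by blast
    next
      fix X :: "('v list \<Rightarrow> 'a) set" assume "X \<in> carrier (H_suf T 1)"
      then obtain c :: "'v list \<Rightarrow> 'a" where c: "c \<in> cycles T 1" "X = {c}" unfolding H by blast
      then obtain f where "bounded_fun f" "\<And>p. p \<notin> P \<Longrightarrow> f p = 0" "bip_sum P f = c"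
        using bip_sum_surj by blast
      then show "X \<in> ?F ` carrier (linf P)" using c carrier unfolding bip_map_eq by blast
    qed
  qed
qed

lemma sup_norm_bip_sum:
  fixes f :: "(int \<Rightarrow> 'v) \<Rightarrow> 'a::normed_coeff_ring"
  assumes "bounded_fun f"
  shows "sup_norm (bip_sum P f) \<le> 3 * sup_norm f"
  unfolding sup_norm_def[of "bip_sum P f"]
  using cnorm_bip_sum[OF sup_norm_upper[OF assms]] by (intro cSUP_least) auto

lemma class_norm_bip_map:
  fixes f :: "(int \<Rightarrow> 'v) \<Rightarrow> 'a::normed_coeff_ring"
  assumes "f \<in> carrier (linf P)"
  shows "class_norm (bip_map V E P f) \<le> 3 * sup_norm f"
  using sup_norm_bip_sum[of f] assms unfolding bip_map_eq class_norm_def linf_def fun_group_def by simp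

text \<open>Classes are singletons and the sum over bips respects differences, so the distance is
  the norm of the flow of \<open>g - f\<close>; this makes the map Lipschitz with constant
  3.\<close>

lemma class_dist_bip_map:
  fixes f g :: "(int \<Rightarrow> 'v) \<Rightarrow> 'a::normed_coeff_ring"
  assumes "f \<in> carrier (linf P)" "g \<in> carrier (linf P)"
  shows "class_dist (bip_map V E P g) (bip_map V E P f) \<le> 3 * sup_norm (\<lambda>p. g p - f p)"
proof -
  have "bounded_fun g" "bounded_fun f" using assms unfolding linf_def fun_group_def by auto
  then have "bounded_fun (\<lambda>p. g p - f p)" using bounded_fun_add[OF _ bounded_fun_minus, of g f] by simp
  moreover have "bip_sum P (\<lambda>p. g p - f p) = (\<lambda>xs. bip_sum P g xs - bip_sum P f xs)"
    unfolding bip_sum_def by (auto simp: sum_subtractf left_diff_distrib)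
  ultimately show ?thesis
    using sup_norm_bip_sum[of "\<lambda>p. g p - f p"] unfolding class_dist_def class_norm_def bip_map_eq by simp
qed

end

theorem theorem3p6:
  fixes V :: "'v set" and E :: "'v set set" and mid :: bool
    and L :: "int \<Rightarrow> 'v" and B :: "nat \<Rightarrow> 'v set" and R :: "'v \<Rightarrow> nat \<Rightarrow> 'v"
    and P :: "(int \<Rightarrow> 'v) set"
  assumes "trivalent_tree V E" and "leafless V E"
    and "ray_construction V E mid L B R"
    and "P = bips mid L B R"
  shows "(bip_map V E P :: ((int \<Rightarrow> 'v) \<Rightarrow> int) \<Rightarrow> _)
           \<in> iso (linf P) (H_suf (graph_complex V E) 1) \<and>
         (suf_to_uf V E 1 :: ('v list \<Rightarrow> int) set \<Rightarrow> _)
           \<in> iso (H_suf (graph_complex V E) 1) (H_uf V E 1) \<and>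
         (bip_map V E P :: ((int \<Rightarrow> 'v) \<Rightarrow> bit) \<Rightarrow> _)
           \<in> iso (linf P) (H_suf (graph_complex V E) 1) \<and>
         (suf_to_uf V E 1 :: ('v list \<Rightarrow> bit) set \<Rightarrow> _)
           \<in> iso (H_suf (graph_complex V E) 1) (H_uf V E 1) \<and>
         (\<forall>f \<in> carrier (linf P :: ((int \<Rightarrow> 'v) \<Rightarrow> int) monoid). \<forall>\<epsilon>>0. \<exists>\<delta>>0.
           \<forall>g \<in> carrier (linf P). sup_norm (\<lambda>p. g p - f p) < \<delta> \<longrightarrow>
             class_dist (bip_map V E P g) (bip_map V E P f) < \<epsilon>) \<and>
         (\<exists>C. \<forall>f \<in> carrier (linf P :: ((int \<Rightarrow> 'v) \<Rightarrow> int) monoid).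
           class_norm (bip_map V E P f) \<le> C * sup_norm f)"
proof -
  interpret trivalent_ray_tree V E mid L B R
    using assms(1,3) by unfold_locales
  \<comment> \<open>The Lipschitz constant 3 allows \<open>\<epsilon> / 3\<close> for
    \<open>\<delta>\<close>.\<close>
  have continuous: "\<exists>\<delta>>0. \<forall>g \<in> carrier (linf (bips mid L B R)). sup_norm (\<lambda>p. g p - f p) < \<delta> \<longrightarrow>
      class_dist (bip_map V E (bips mid L B R) g) (bip_map V E (bips mid L B R) f) < \<epsilon>"
    if "f \<in> carrier (linf (bips mid L B R))" "\<epsilon> > 0" for f :: "(int \<Rightarrow> 'v) \<Rightarrow> int" and \<epsilon>
    using class_dist_bip_map[OF that(1)] that(2) by (intro exI[of _ "\<epsilon> / 3"]) fastforce
  show ?thesis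
    unfolding assms(4)
  proof (intro conjI ballI allI impI)
    show "\<exists>C. \<forall>f\<in>carrier (linf (bips mid L B R) :: ((int \<Rightarrow> 'v) \<Rightarrow> int) monoid).
        class_norm (bip_map V E (bips mid L B R) f) \<le> C * sup_norm f"
      using class_norm_bip_map by blast
  qed (rule bip_map_iso suf_to_uf_iso continuous; assumption)+
qed

end
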